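(* Let $R$ be a (commutative) principal ideal domain, $\sigma\in\mathrm{Aut}(R)$, $0\ne a\in R$, $A=R(\sigma,a)$ the corresponding generalized Weyl algebra, $\mathsf p$ a divisor of $a$ and $\mathsf q=\sigma(a/\mathsf p)$. Then the $A$-module $V_{\mathsf p}$ has finite length if and only if all $\mathcal G$-orbits in $\mathrm{Irr}(R)$ are infinite. In this case, the length of $V_{\mathsf p}$ is bounded above by $1+|\Omega_{\mathsf p}|$, where $$\Omega_{\mathsf p}:=\{(z,w)\in\mathrm{Irr}(\mathsf q)\times\mathrm{Irr}(\mathsf p)\mid z\preccurlyeq w\}$$ with its cardinality $|\Omega_{\mathsf p}|$ considered in the sense of multisets (i.e. pairs are counted with multiplicity).
   Context: Modules are left and unital. The generalized Weyl algebra $R(\sigma,a)$ is the ring generated by $R$, $x$, $y$ subject to $x\sigma(r)=rx$, $yr=\sigma(r)y$ for all $r\in R$, $xy=a$, $yx=\sigma(a)$. For a divisor $\mathsf p$ of $a$ and $\mathsf q=\sigma(a/\mathsf p)$, the $A$-module $V_{\mathsf p}$ is $R$ as an abelian group, with $r'\cdot r=r'r$, $x\cdot r=\sigma^{-1}(r)\mathsf p$, $y\cdot r=\sigma(r)\mathsf q$. $[r]$ denotes the class of $r\in R$ up to associates. $\mathrm{Irr}(R)$ is the set of classes of irreducible elements of $R$. For $0\ne r\in R$, $\mathrm{Irr}(r)$ is the multiset of classes of irreducible factors of $r$, counted with multiplicity; products of multisets are taken with multiplicity. $\mathcal G=\langle\sigma\rangle\le\mathrm{Aut}(R)$ acts on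 $\mathrm{Irr}(R)$ by $\sigma\cdot[r]=[\sigma(r)]$. The relation $\preccurlyeq$ on $\mathrm{Irr}(R)$ is: $[r]\preccurlyeq[s]$ iff $[\sigma^n(r)]=[s]$ for some $n\ge 0$. *)

theory Defs
  imports
    "HOL-Algebra.Ring_Divisibility"
    "HOL-Algebra.Elementary_Groups"
    "HOL-Algebra.Group_Action"
    "HOL-Algebra.Bij"
    "HOL-Algebra.Module"
    "HOL-Library.Extended_Nat"
begin

section \<open>Ring automorphisms\<close>

text \<open>As in the library's \<open>AutoGroup\<close>, automorphisms are extensional functions, so that the
  group operations are composition and inversion of maps on the carrier.\<close>

definition ring_AutoGroup :: "('a, 'm) ring_scheme \<Rightarrow> ('a \<Rightarrow> 'a) monoid"
  where "ring_AutoGroup R =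
    BijGroup (carrier R) \<lparr>carrier := Bij (carrier R) \<inter> ring_hom R R\<rparr>"


section \<open>Generalized Weyl algebras\<close>

text \<open>The ring generated by \<open>R\<close>, \<open>x\<close>, \<open>y\<close> subject to relations is constructed as the set of
  ring expressions in these generators, modulo the least congruence that satisfies the laws of
  unital rings, makes \<open>Coeff\<close> a unital ring homomorphism and contains the defining relations.
  Zero and one are the expressions \<open>Coeff \<zero>\<close> and \<open>Coeff \<one>\<close>.\<close>

datatype 'a gwa_term =
    Coeff 'a
  | GenX
  | GenY
  | Plus "'a gwa_term" "'a gwa_term"
  | Neg "'a gwa_term"
  | Times "'a gwa_term" "'a gwa_term"

definition gwa_terms :: "('a, 'm) ring_scheme \<Rightarrow> 'a gwa_term set"
  where "gwa_terms R = {t. set_gwa_term t \<subseteq> carrier R}"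

inductive gwa_eq ::
    "('a, 'm) ring_scheme \<Rightarrow> ('a \<Rightarrow> 'a) \<Rightarrow> 'a \<Rightarrow> 'a gwa_term \<Rightarrow> 'a gwa_term \<Rightarrow> bool"
  for R (structure) and \<sigma> a
  where
    refl: "s \<in> gwa_terms R \<Longrightarrow> gwa_eq R \<sigma> a s s"
  | sym: "gwa_eq R \<sigma> a s t \<Longrightarrow> gwa_eq R \<sigma> a t s"
  | trans: "gwa_eq R \<sigma> a s t \<Longrightarrow> gwa_eq R \<sigma> a t u \<Longrightarrow> gwa_eq R \<sigma> a s u"
  | Plus_cong: "gwa_eq R \<sigma> a s s' \<Longrightarrow> gwa_eq R \<sigma> a t t' \<Longrightarrow>
      gwa_eq R \<sigma> a (Plus s t) (Plus s' t')"
  | Neg_cong: "gwa_eq R \<sigma> a s s' \<Longrightarrow> gwa_eq R \<sigma> a (Neg s) (Neg s')"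
  | Times_cong: "gwa_eq R \<sigma> a s s' \<Longrightarrow> gwa_eq R \<sigma> a t t' \<Longrightarrow>
      gwa_eq R \<sigma> a (Times s t) (Times s' t')"
  | Plus_assoc: "s \<in> gwa_terms R \<Longrightarrow> t \<in> gwa_terms R \<Longrightarrow> u \<in> gwa_terms R \<Longrightarrow>
      gwa_eq R \<sigma> a (Plus (Plus s t) u) (Plus s (Plus t u))"
  | Plus_comm: "s \<in> gwa_terms R \<Longrightarrow> t \<in> gwa_terms R \<Longrightarrow>
      gwa_eq R \<sigma> a (Plus s t) (Plus t s)"
  | Plus_zero: "s \<in> gwa_terms R \<Longrightarrow> gwa_eq R \<sigma> a (Plus (Coeff \<zero>) s) s"
  | Plus_Neg: "s \<in> gwa_terms R \<Longrightarrow> gwa_eq R \<sigma> a (Plus (Neg s) s) (Coeff \<zero>)"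
  | Times_assoc: "s \<in> gwa_terms R \<Longrightarrow> t \<in> gwa_terms R \<Longrightarrow> u \<in> gwa_terms R \<Longrightarrow>
      gwa_eq R \<sigma> a (Times (Times s t) u) (Times s (Times t u))"
  | one_Times: "s \<in> gwa_terms R \<Longrightarrow> gwa_eq R \<sigma> a (Times (Coeff \<one>) s) s"
  | Times_one: "s \<in> gwa_terms R \<Longrightarrow> gwa_eq R \<sigma> a (Times s (Coeff \<one>)) s"
  | distrib_right: "s \<in> gwa_terms R \<Longrightarrow> t \<in> gwa_terms R \<Longrightarrow> u \<in> gwa_terms R \<Longrightarrow>
      gwa_eq R \<sigma> a (Times (Plus s t) u) (Plus (Times s u) (Times t u))"
  | distrib_left: "s \<in> gwa_terms R \<Longrightarrow> t \<in> gwa_terms R \<Longrightarrow> u \<in> gwa_terms R \<Longrightarrow>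
      gwa_eq R \<sigma> a (Times u (Plus s t)) (Plus (Times u s) (Times u t))"
  | Coeff_add: "r \<in> carrier R \<Longrightarrow> r' \<in> carrier R \<Longrightarrow>
      gwa_eq R \<sigma> a (Coeff (r \<oplus> r')) (Plus (Coeff r) (Coeff r'))"
  | Coeff_mult: "r \<in> carrier R \<Longrightarrow> r' \<in> carrier R \<Longrightarrow>
      gwa_eq R \<sigma> a (Coeff (r \<otimes> r')) (Times (Coeff r) (Coeff r'))"
  | rel_x: "r \<in> carrier R \<Longrightarrow>
      gwa_eq R \<sigma> a (Times GenX (Coeff (\<sigma> r))) (Times (Coeff r) GenX)"
  | rel_y: "r \<in> carrier R \<Longrightarrow>
      gwa_eq R \<sigma> a (Times GenY (Coeff r)) (Times (Coeff (\<sigma> r)) GenY)"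
  | rel_xy: "gwa_eq R \<sigma> a (Times GenX GenY) (Coeff a)"
  | rel_yx: "gwa_eq R \<sigma> a (Times GenY GenX) (Coeff (\<sigma> a))"

definition gwa_class ::
    "('a, 'm) ring_scheme \<Rightarrow> ('a \<Rightarrow> 'a) \<Rightarrow> 'a \<Rightarrow> 'a gwa_term \<Rightarrow> 'a gwa_term set"
  where "gwa_class R \<sigma> a t = {s. gwa_eq R \<sigma> a t s}"

definition gwa :: "('a, 'm) ring_scheme \<Rightarrow> ('a \<Rightarrow> 'a) \<Rightarrow> 'a \<Rightarrow> 'a gwa_term set ring"
  where "gwa R \<sigma> a =
    \<lparr>carrier = gwa_class R \<sigma> a ` gwa_terms R,
     monoid.mult = (\<lambda>S T. gwa_class R \<sigma> a (Times (SOME s. s \<in> S) (SOME t. t \<in> T))),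
     one = gwa_class R \<sigma> a (Coeff \<one>\<^bsub>R\<^esub>),
     zero = gwa_class R \<sigma> a (Coeff \<zero>\<^bsub>R\<^esub>),
     add = (\<lambda>S T. gwa_class R \<sigma> a (Plus (SOME s. s \<in> S) (SOME t. t \<in> T)))\<rparr>"


section \<open>Left modules and their length\<close>

text \<open>The library's \<open>module\<close> locale requires a commutative ring of scalars; the record
  \<open>module\<close> and the locale \<open>submodule\<close> do not.\<close>

locale left_module = A?: ring A + M?: abelian_group M
  for A :: "('s, 't) ring_scheme" (structure)
    and M :: "('s, 'v, 'w) module_scheme" (structure) +
  assumes smult_closed:
      "\<lbrakk>r \<in> carrier A; x \<in> carrier M\<rbrakk> \<Longrightarrow> r \<odot>\<^bsub>M\<^esub> x \<in> carrier M"
    and smult_l_distr: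
      "\<lbrakk>r \<in> carrier A; s \<in> carrier A; x \<in> carrier M\<rbrakk> \<Longrightarrow>
        (r \<oplus>\<^bsub>A\<^esub> s) \<odot>\<^bsub>M\<^esub> x = r \<odot>\<^bsub>M\<^esub> x \<oplus>\<^bsub>M\<^esub> s \<odot>\<^bsub>M\<^esub> x"
    and smult_r_distr:
      "\<lbrakk>r \<in> carrier A; x \<in> carrier M; y \<in> carrier M\<rbrakk> \<Longrightarrow>
        r \<odot>\<^bsub>M\<^esub> (x \<oplus>\<^bsub>M\<^esub> y) = r \<odot>\<^bsub>M\<^esub> x \<oplus>\<^bsub>M\<^esub> r \<odot>\<^bsub>M\<^esub> y"
    and smult_assoc1:
      "\<lbrakk>r \<in> carrier A; s \<in> carrier A; x \<in> carrier M\<rbrakk> \<Longrightarrow>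
        (r \<otimes>\<^bsub>A\<^esub> s) \<odot>\<^bsub>M\<^esub> x = r \<odot>\<^bsub>M\<^esub> (s \<odot>\<^bsub>M\<^esub> x)"
    and smult_one: "x \<in> carrier M \<Longrightarrow> \<one>\<^bsub>A\<^esub> \<odot>\<^bsub>M\<^esub> x = x"

text \<open>The length is the supremum of the lengths \<open>n\<close> of chains
  \<open>N\<^sub>0 \<subset> N\<^sub>1 \<subset> \<dots> \<subset> N\<^sub>n\<close> of submodules.\<close>

definition module_length :: "('s, 't) ring_scheme \<Rightarrow> ('s, 'v, 'w) module_scheme \<Rightarrow> enat"
  where "module_length A M =
    Sup {enat n | n. \<exists>N. (\<forall>i\<le>n. submodule (N i) A M) \<and> (\<forall>i<n. N i \<subset> N (Suc i))}"

definition finite_length :: "('s, 't) ring_scheme \<Rightarrow> ('s, 'v, 'w) module_scheme \<Rightarrow> bool"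
  where "finite_length A M \<longleftrightarrow> module_length A M < \<infinity>"


section \<open>The modules \<open>V\<^sub>p\<close>\<close>

text \<open>The quotient \<open>a/p\<close> of \<open>a\<close> by a divisor \<open>p \<noteq> 0\<close> in a domain.\<close>

definition ring_quotient :: "('a, 'm) ring_scheme \<Rightarrow> 'a \<Rightarrow> 'a \<Rightarrow> 'a"
  where "ring_quotient R a p = (THE b. b \<in> carrier R \<and> a = p \<otimes>\<^bsub>R\<^esub> b)"

primrec gwa_act ::
    "('a, 'm) ring_scheme \<Rightarrow> ('a \<Rightarrow> 'a) \<Rightarrow> 'a \<Rightarrow> 'a \<Rightarrow> 'a gwa_term \<Rightarrow> 'a \<Rightarrow> 'a"
  where
    "gwa_act R \<sigma> p q (Coeff c) r = c \<otimes>\<^bsub>R\<^esub> r"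
  | "gwa_act R \<sigma> p q GenX r = inv_into (carrier R) \<sigma> r \<otimes>\<^bsub>R\<^esub> p"
  | "gwa_act R \<sigma> p q GenY r = \<sigma> r \<otimes>\<^bsub>R\<^esub> q"
  | "gwa_act R \<sigma> p q (Plus s t) r = gwa_act R \<sigma> p q s r \<oplus>\<^bsub>R\<^esub> gwa_act R \<sigma> p q t r"
  | "gwa_act R \<sigma> p q (Neg s) r = \<ominus>\<^bsub>R\<^esub> gwa_act R \<sigma> p q s r"
  | "gwa_act R \<sigma> p q (Times s t) r = gwa_act R \<sigma> p q s (gwa_act R \<sigma> p q t r)"

text \<open>The fields \<open>mult\<close> and \<open>one\<close> of the record play no role in the module structure.\<close>

definition gwa_V ::
    "('a, 'm) ring_scheme \<Rightarrow> ('a \<Rightarrow> 'a) \<Rightarrow> 'a \<Rightarrow> 'a \<Rightarrow> ('a gwa_term set, 'a) module"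
  where "gwa_V R \<sigma> p q =
    \<lparr>carrier = carrier R, monoid.mult = mult R, one = \<one>\<^bsub>R\<^esub>, zero = \<zero>\<^bsub>R\<^esub>, add = add R,
     smult = (\<lambda>T r. gwa_act R \<sigma> p q (SOME t. t \<in> T) r)\<rparr>"


section \<open>Classes of irreducible elements\<close>

definition assoc_class :: "('a, 'm) ring_scheme \<Rightarrow> 'a \<Rightarrow> 'a set"
  where "assoc_class R r = assocs (mult_of R) r"

definition Irr :: "('a, 'm) ring_scheme \<Rightarrow> 'a set set"
  where "Irr R = assoc_class R ` {r \<in> carrier R. ring_irreducible\<^bsub>R\<^esub> r}"

definition Irr_mset :: "('a, 'm) ring_scheme \<Rightarrow> 'a \<Rightarrow> 'a set multiset"
  where "Irr_mset R r =
    (THE M. \<exists>fs. set fs \<subseteq> carrier (mult_of R) \<and> wfactors (mult_of R) fs r \<and>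
                 M = fmset (mult_of R) fs)"

text \<open>An automorphism \<open>g\<close> acts by \<open>g \<cdot> [r] = [g r]\<close>, which is the image of the set \<open>[r]\<close>
  under \<open>g\<close>; see \<open>image_assoc_class\<close> below.\<close>

definition Irr_orbits :: "('a, 'm) ring_scheme \<Rightarrow> ('a \<Rightarrow> 'a) \<Rightarrow> 'a set set set"
  where "Irr_orbits R \<sigma> =
    orbits (subgroup_generated (ring_AutoGroup R) {\<sigma>}) (Irr R) (\<lambda>g c. g ` c)"

definition Irr_le :: "('a, 'm) ring_scheme \<Rightarrow> ('a \<Rightarrow> 'a) \<Rightarrow> 'a set \<Rightarrow> 'a set \<Rightarrow> bool"
  where "Irr_le R \<sigma> z w \<longleftrightarrow>
    (\<exists>r s. r \<in> carrier R \<and> ring_irreducible\<^bsub>R\<^esub> r \<and> s \<in> carrier R \<and> ring_irreducible\<^bsub>R\<^esub> s \<and>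
       z = assoc_class R r \<and> w = assoc_class R s \<and>
       (\<exists>n::nat. assoc_class R ((\<sigma> ^^ n) r) = assoc_class R s))"

definition Omega ::
    "('a, 'm) ring_scheme \<Rightarrow> ('a \<Rightarrow> 'a) \<Rightarrow> 'a \<Rightarrow> 'a \<Rightarrow> ('a set \<times> 'a set) multiset"
  where "Omega R \<sigma> p q =
    {#(z, w) \<in># (\<Sum>z\<in>#Irr_mset R q. {#(z, w). w \<in># Irr_mset R p#}). Irr_le R \<sigma> z w#}"

section \<open>Well-definedness\<close>

lemma ring_AutoGroupD:
  assumes "\<sigma> \<in> carrier (ring_AutoGroup R)"
  shows "\<sigma> \<in> ring_hom R R" "bij_betw \<sigma> (carrier R) (carrier R)"
  using assms by (auto simp: ring_AutoGroup_def Bij_def)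

lemma gwa_terms_simps [simp]:
  "Coeff r \<in> gwa_terms R \<longleftrightarrow> r \<in> carrier R"
  "GenX \<in> gwa_terms R" "GenY \<in> gwa_terms R"
  "Plus s t \<in> gwa_terms R \<longleftrightarrow> s \<in> gwa_terms R \<and> t \<in> gwa_terms R"
  "Neg s \<in> gwa_terms R \<longleftrightarrow> s \<in> gwa_terms R"
  "Times s t \<in> gwa_terms R \<longleftrightarrow> s \<in> gwa_terms R \<and> t \<in> gwa_terms R"
  by (auto simp: gwa_terms_def)

locale gwa_data = cring R for R (structure) +
  fixes \<sigma> a
  assumes \<sigma>_aut: "\<sigma> \<in> carrier (ring_AutoGroup R)"
    and a_carrier [simp, intro]: "a \<in> carrier R"
begin

abbreviation "\<tau> \<equiv> inv_into (carrier R) \<sigma>"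

lemma \<sigma>_closed [simp, intro]: "r \<in> carrier R \<Longrightarrow> \<sigma> r \<in> carrier R"
  using ring_AutoGroupD[OF \<sigma>_aut] by (auto simp: bij_betw_def)

lemma \<sigma>_hom [simp]:
  "r \<in> carrier R \<Longrightarrow> s \<in> carrier R \<Longrightarrow> \<sigma> (r \<oplus> s) = \<sigma> r \<oplus> \<sigma> s"
  "r \<in> carrier R \<Longrightarrow> s \<in> carrier R \<Longrightarrow> \<sigma> (r \<otimes> s) = \<sigma> r \<otimes> \<sigma> s"
  "\<sigma> \<one> = \<one>"
  using ring_AutoGroupD(1)[OF \<sigma>_aut] by (auto simp: ring_hom_def)

lemma \<tau>_closed [simp, intro]: "r \<in> carrier R \<Longrightarrow> \<tau> r \<in> carrier R"
  using ring_AutoGroupD(2)[OF \<sigma>_aut] by (metis bij_betw_def inv_into_into)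

lemma \<sigma>_\<tau> [simp]: "r \<in> carrier R \<Longrightarrow> \<sigma> (\<tau> r) = r"
  using ring_AutoGroupD(2)[OF \<sigma>_aut] by (simp add: bij_betw_inv_into_right)

lemma \<tau>_\<sigma> [simp]: "r \<in> carrier R \<Longrightarrow> \<tau> (\<sigma> r) = r"
  using ring_AutoGroupD(2)[OF \<sigma>_aut] by (simp add: bij_betw_inv_into_left)

lemma \<tau>_hom [simp]:
  assumes "r \<in> carrier R" "s \<in> carrier R"
  shows "\<tau> (r \<oplus> s) = \<tau> r \<oplus> \<tau> s" "\<tau> (r \<otimes> s) = \<tau> r \<otimes> \<tau> s"
proof -
  have "\<tau> (\<sigma> (\<tau> r \<oplus> \<tau> s)) = \<tau> r \<oplus> \<tau> s" using assms by (intro \<tau>_\<sigma>) auto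
  then show "\<tau> (r \<oplus> s) = \<tau> r \<oplus> \<tau> s" using assms by simp
  have "\<tau> (\<sigma> (\<tau> r \<otimes> \<tau> s)) = \<tau> r \<otimes> \<tau> s" using assms by (intro \<tau>_\<sigma>) auto
  then show "\<tau> (r \<otimes> s) = \<tau> r \<otimes> \<tau> s" using assms by simp
qed

lemma gwa_eq_terms:
  assumes "gwa_eq R \<sigma> a s t" shows "s \<in> gwa_terms R \<and> t \<in> gwa_terms R"
  using assms by induction auto

lemma gwa_class_eq_iff:
  assumes "s \<in> gwa_terms R"
  shows "gwa_class R \<sigma> a s = gwa_class R \<sigma> a t \<longleftrightarrow> gwa_eq R \<sigma> a s t"
proof
  assume "gwa_class R \<sigma> a s = gwa_class R \<sigma> a t"
  moreover have "s \<in> gwa_class R \<sigma> a s"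
    using assms by (simp add: gwa_class_def gwa_eq.refl)
  ultimately show "gwa_eq R \<sigma> a s t" by (auto simp: gwa_class_def intro: gwa_eq.sym)
next
  assume "gwa_eq R \<sigma> a s t"
  then show "gwa_class R \<sigma> a s = gwa_class R \<sigma> a t"
    by (auto simp: gwa_class_def intro: gwa_eq.sym gwa_eq.trans)
qed

lemma gwa_class_eqI:
  "gwa_eq R \<sigma> a s t \<Longrightarrow> gwa_class R \<sigma> a s = gwa_class R \<sigma> a t"
  using gwa_class_eq_iff gwa_eq_terms by blast

lemma gwa_eq_some:
  assumes "s \<in> gwa_terms R" shows "gwa_eq R \<sigma> a s (SOME t. t \<in> gwa_class R \<sigma> a s)"
proof -
  have "s \<in> gwa_class R \<sigma> a s"
    using assms by (simp add: gwa_class_def gwa_eq.refl)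
  then have "(SOME t. t \<in> gwa_class R \<sigma> a s) \<in> gwa_class R \<sigma> a s" by (rule someI)
  then show ?thesis by (simp add: gwa_class_def)
qed

lemma gwa_simps:
  "carrier (gwa R \<sigma> a) = gwa_class R \<sigma> a ` gwa_terms R"
  "\<one>\<^bsub>gwa R \<sigma> a\<^esub> = gwa_class R \<sigma> a (Coeff \<one>)"
  "\<zero>\<^bsub>gwa R \<sigma> a\<^esub> = gwa_class R \<sigma> a (Coeff \<zero>)"
  by (simp_all add: gwa_def)

lemma gwa_add:
  assumes "s \<in> gwa_terms R" "t \<in> gwa_terms R"
  shows "gwa_class R \<sigma> a s \<oplus>\<^bsub>gwa R \<sigma> a\<^esub> gwa_class R \<sigma> a t = gwa_class R \<sigma> a (Plus s t)"
proof -
  have "gwa_eq R \<sigma> a (Plus s t)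
      (Plus (SOME u. u \<in> gwa_class R \<sigma> a s) (SOME u. u \<in> gwa_class R \<sigma> a t))"
    using assms by (intro gwa_eq.Plus_cong gwa_eq_some)
  then have "gwa_class R \<sigma> a (Plus s t) = gwa_class R \<sigma> a
      (Plus (SOME u. u \<in> gwa_class R \<sigma> a s) (SOME u. u \<in> gwa_class R \<sigma> a t))"
    using assms by (subst gwa_class_eq_iff) auto
  then show ?thesis by (simp add: gwa_def)
qed

lemma gwa_mult:
  assumes "s \<in> gwa_terms R" "t \<in> gwa_terms R"
  shows "gwa_class R \<sigma> a s \<otimes>\<^bsub>gwa R \<sigma> a\<^esub> gwa_class R \<sigma> a t = gwa_class R \<sigma> a (Times s t)"
proof -
  have "gwa_eq R \<sigma> a (Times s t)
      (Times (SOME u. u \<in> gwa_class R \<sigma> a s) (SOME u. u \<in> gwa_class R \<sigma> a t))"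
    using assms by (intro gwa_eq.Times_cong gwa_eq_some)
  then have "gwa_class R \<sigma> a (Times s t) = gwa_class R \<sigma> a
      (Times (SOME u. u \<in> gwa_class R \<sigma> a s) (SOME u. u \<in> gwa_class R \<sigma> a t))"
    using assms by (subst gwa_class_eq_iff) auto
  then show ?thesis by (simp add: gwa_def)
qed

theorem ring_gwa: "ring (gwa R \<sigma> a)"
proof (rule ringI)
  show "abelian_group (gwa R \<sigma> a)"
  proof (rule abelian_groupI)
    fix x assume "x \<in> carrier (gwa R \<sigma> a)"
    then obtain s where s: "s \<in> gwa_terms R" "x = gwa_class R \<sigma> a s" by (auto simp: gwa_simps)
    then have "gwa_class R \<sigma> a (Neg s) \<oplus>\<^bsub>gwa R \<sigma> a\<^esub> x = \<zero>\<^bsub>gwa R \<sigma> a\<^esub>"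
      by (auto simp: gwa_simps gwa_add gwa_class_eq_iff intro: gwa_eq.Plus_Neg)
    then show "\<exists>y\<in>carrier (gwa R \<sigma> a). y \<oplus>\<^bsub>gwa R \<sigma> a\<^esub> x = \<zero>\<^bsub>gwa R \<sigma> a\<^esub>"
      using s by (intro bexI[of _ "gwa_class R \<sigma> a (Neg s)"]) (auto simp: gwa_simps)
  next
    fix x y assume "x \<in> carrier (gwa R \<sigma> a)" "y \<in> carrier (gwa R \<sigma> a)"
    then obtain s t where "s \<in> gwa_terms R" "t \<in> gwa_terms R"
      "x = gwa_class R \<sigma> a s" "y = gwa_class R \<sigma> a t" by (auto simp: gwa_simps)
    then show "x \<oplus>\<^bsub>gwa R \<sigma> a\<^esub> y = y \<oplus>\<^bsub>gwa R \<sigma> a\<^esub> x"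
      by (simp add: gwa_add gwa_class_eqI[OF gwa_eq.Plus_comm[of s R t]])
  qed (auto simp: gwa_simps gwa_add
        gwa_class_eqI[OF gwa_eq.Plus_assoc] gwa_class_eqI[OF gwa_eq.Plus_zero])
  show "Group.monoid (gwa R \<sigma> a)"
    by (rule monoidI) (auto simp: gwa_simps gwa_mult
        gwa_class_eqI[OF gwa_eq.Times_assoc] gwa_class_eqI[OF gwa_eq.one_Times]
        gwa_class_eqI[OF gwa_eq.Times_one])
qed (auto simp: gwa_simps gwa_add gwa_mult
      gwa_class_eqI[OF gwa_eq.distrib_left] gwa_class_eqI[OF gwa_eq.distrib_right])

end

locale gwa_V_data = gwa_data +
  fixes p b q
  assumes p_carrier [simp]: "p \<in> carrier R" and b_carrier [simp]: "b \<in> carrier R"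
    and a_eq: "a = p \<otimes> b" and q_eq: "q = \<sigma> b"
begin

lemma q_carrier [simp]: "q \<in> carrier R" by (simp add: q_eq)

lemma gwa_act_closed [simp]:
  "t \<in> gwa_terms R \<Longrightarrow> r \<in> carrier R \<Longrightarrow> gwa_act R \<sigma> p q t r \<in> carrier R"
  by (induction t arbitrary: r) auto

lemma gwa_act_add:
  "t \<in> gwa_terms R \<Longrightarrow> r \<in> carrier R \<Longrightarrow> r' \<in> carrier R \<Longrightarrow>
     gwa_act R \<sigma> p q t (r \<oplus> r') = gwa_act R \<sigma> p q t r \<oplus> gwa_act R \<sigma> p q t r'"
  by (induction t arbitrary: r r') (auto simp: l_distr r_distr a_ac minus_add)

lemma gwa_act_eq:
  assumes "gwa_eq R \<sigma> a s t" "r \<in> carrier R"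
  shows "gwa_act R \<sigma> p q s r = gwa_act R \<sigma> p q t r"
  using assms
proof (induction arbitrary: r)
  case (Times_cong s s' t t')
  then show ?case using gwa_eq_terms[OF Times_cong.hyps(2)] by simp
next
  case rel_xy
  then show ?case by (simp add: a_eq q_eq m_ac)
next
  case rel_yx
  then show ?case by (simp add: a_eq q_eq m_ac)
qed (simp_all add: a_ac m_assoc gwa_act_add l_distr r_distr l_neg r_neg)

lemma gwa_V_simps:
  "carrier (gwa_V R \<sigma> p q) = carrier R" "\<zero>\<^bsub>gwa_V R \<sigma> p q\<^esub> = \<zero>"
  "x \<oplus>\<^bsub>gwa_V R \<sigma> p q\<^esub> y = x \<oplus> y"
  by (simp_all add: gwa_V_def)

lemma gwa_V_smult:
  assumes "t \<in> gwa_terms R" "r \<in> carrier R"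
  shows "gwa_class R \<sigma> a t \<odot>\<^bsub>gwa_V R \<sigma> p q\<^esub> r = gwa_act R \<sigma> p q t r"
  using gwa_act_eq[OF gwa_eq_some[OF assms(1)] assms(2)] by (simp add: gwa_V_def)

theorem left_module_gwa_V:
  "left_module (gwa R \<sigma> a) (gwa_V R \<sigma> p q)" (is "left_module ?A ?V")
proof -
  interpret A: ring "gwa R \<sigma> a" by (rule ring_gwa)
  interpret M: abelian_group "gwa_V R \<sigma> p q"
  proof (rule abelian_groupI)
    fix x assume "x \<in> carrier (gwa_V R \<sigma> p q)"
    then show "\<exists>y\<in>carrier (gwa_V R \<sigma> p q). y \<oplus>\<^bsub>gwa_V R \<sigma> p q\<^esub> x = \<zero>\<^bsub>gwa_V R \<sigma> p q\<^esub>"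
      by (intro bexI[of _ "\<ominus> x"]) (simp_all add: gwa_V_simps l_neg)
  qed (simp_all add: gwa_V_simps a_ac)
  show ?thesis
  proof (intro left_module.intro left_module_axioms.intro)
    show "ring (gwa R \<sigma> a)" by (rule ring_gwa)
    show "abelian_group (gwa_V R \<sigma> p q)" by (rule M.abelian_group_axioms)
  next
    show "r \<odot>\<^bsub>?V\<^esub> x \<in> carrier ?V"
      if "r \<in> carrier ?A" "x \<in> carrier ?V" for r x
      using that by (auto simp: gwa_simps gwa_V_smult gwa_V_simps)
    show "(r \<oplus>\<^bsub>?A\<^esub> s) \<odot>\<^bsub>?V\<^esub> x = r \<odot>\<^bsub>?V\<^esub> x \<oplus>\<^bsub>?V\<^esub> s \<odot>\<^bsub>?V\<^esub> x"
      if "r \<in> carrier ?A" "s \<in> carrier ?A" "x \<in> carrier ?V" for r s x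
      using that by (auto simp: gwa_simps gwa_add gwa_V_smult gwa_V_simps)
    show "r \<odot>\<^bsub>?V\<^esub> (x \<oplus>\<^bsub>?V\<^esub> y) = r \<odot>\<^bsub>?V\<^esub> x \<oplus>\<^bsub>?V\<^esub> r \<odot>\<^bsub>?V\<^esub> y"
      if "r \<in> carrier ?A" "x \<in> carrier ?V" "y \<in> carrier ?V" for r x y
      using that by (auto simp: gwa_simps gwa_V_smult gwa_V_simps gwa_act_add)
    show "(r \<otimes>\<^bsub>?A\<^esub> s) \<odot>\<^bsub>?V\<^esub> x = r \<odot>\<^bsub>?V\<^esub> (s \<odot>\<^bsub>?V\<^esub> x)"
      if "r \<in> carrier ?A" "s \<in> carrier ?A" "x \<in> carrier ?V" for r s x
      using that by (auto simp: gwa_simps gwa_mult gwa_V_smult gwa_V_simps)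
    show "\<one>\<^bsub>?A\<^esub> \<odot>\<^bsub>?V\<^esub> x = x"
      if "x \<in> carrier ?V" for x
      using that by (auto simp: gwa_simps gwa_V_smult gwa_V_simps)
  qed
qed

end

lemma (in domain) ring_quotient_eq:
  assumes "p \<in> carrier R" "p \<noteq> \<zero>" "b \<in> carrier R"
  shows "ring_quotient R (p \<otimes> b) p = b"
  unfolding ring_quotient_def using assms by (intro the_equality) (auto simp: m_lcancel)

corollary (in domain) left_module_gwa_V:
  assumes "\<sigma> \<in> carrier (ring_AutoGroup R)" "a \<in> carrier R" "a \<noteq> \<zero>"
    and "p \<in> carrier R" "p divides a" "q = \<sigma> (ring_quotient R a p)"
  shows "left_module (gwa R \<sigma> a) (gwa_V R \<sigma> p q)"
proof -
  obtain b where b: "b \<in> carrier R" "a = p \<otimes> b" using assms(5) unfolding factor_def by blast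
  have "p \<noteq> \<zero>" using b assms(3) by auto
  then have "q = \<sigma> b" using b assms(4,6) ring_quotient_eq by simp
  then have "gwa_V_data R \<sigma> a p b q"
    using assms(1,2,4) b
    by (intro gwa_V_data.intro gwa_data.intro gwa_data_axioms.intro gwa_V_data_axioms.intro is_cring)
  then show ?thesis by (rule gwa_V_data.left_module_gwa_V)
qed

lemma (in domain) image_assoc_class:
  assumes g: "g \<in> carrier (ring_AutoGroup R)" and r: "r \<in> carrier R" "r \<noteq> \<zero>"
  shows "g ` assoc_class R r = assoc_class R (g r)"
proof -
  interpret gwa_data R g \<one> using g by unfold_locales auto
  have g0: "g x \<noteq> \<zero>" if "x \<in> carrier R" "x \<noteq> \<zero>" for x
  proof
    assume "g x = \<zero>"
    moreover have "g \<zero> = \<zero>" using \<sigma>_hom(1)[of \<zero> \<zero>] by (simp add: add.r_cancel_one')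
    ultimately show False using \<tau>_\<sigma>[of x] \<tau>_\<sigma>[of \<zero>] that by simp
  qed
  have cls: "assoc_class R x = {y \<in> carrier R - {\<zero>}. y \<sim> x}" if "x \<in> carrier R" "x \<noteq> \<zero>" for x
  proof -
    have "y \<sim>\<^bsub>mult_of R\<^esub> x \<longleftrightarrow> y \<sim> x" if "y \<in> carrier R" for y
      using assoc_iff_assoc_mult[OF that \<open>x \<in> carrier R\<close>] by simp
    then show ?thesis
      unfolding assoc_class_def eq_closure_of_def elem_def by auto
  qed
  have dvd: "g x divides g y \<longleftrightarrow> x divides y" if "x \<in> carrier R" "y \<in> carrier R" for x y
  proof
    assume "g x divides g y"
    then obtain c where c: "c \<in> carrier R" "g y = g x \<otimes> c" unfolding factor_def by blast
    have "\<tau> (g x \<otimes> c) = x \<otimes> \<tau> c" using that c(1) by simp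
    then have "y = x \<otimes> \<tau> c" using \<tau>_\<sigma>[OF that(2)] c(2) by metis
    then show "x divides y" using c(1) \<tau>_closed unfolding factor_def by blast
  next
    assume "x divides y"
    then obtain c where c: "c \<in> carrier R" "y = x \<otimes> c" unfolding factor_def by blast
    then have "g y = g x \<otimes> g c" using that by simp
    then show "g x divides g y" using c(1) \<sigma>_closed unfolding factor_def by blast
  qed
  show ?thesis
  proof (intro subset_antisym subsetI)
    fix y assume "y \<in> g ` assoc_class R r"
    then show "y \<in> assoc_class R (g r)" using r by (auto simp: cls g0 associated_def dvd)
  next
    fix y assume "y \<in> assoc_class R (g r)"
    then have y: "y \<in> carrier R" "y \<noteq> \<zero>" "y \<sim> g r" using r by (auto simp: cls g0)
    have "g \<zero> = \<zero>" using \<sigma>_hom(1)[of \<zero> \<zero>] by (simp add: add.r_cancel_one')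
    then have "\<tau> y \<noteq> \<zero>" using y(1,2) \<sigma>_\<tau>[of y] by metis
    moreover have "\<tau> y \<sim> r"
      using y(3) dvd[OF \<tau>_closed[OF y(1)] r(1)] dvd[OF r(1) \<tau>_closed[OF y(1)]]
      unfolding associated_def \<sigma>_\<tau>[OF y(1)] by blast
    ultimately have "\<tau> y \<in> assoc_class R r"
      unfolding cls[OF r] using \<tau>_closed[OF y(1)] by blast
    then have "g (\<tau> y) \<in> g ` assoc_class R r" by (rule imageI)
    then show "y \<in> g ` assoc_class R r" unfolding \<sigma>_\<tau>[OF y(1)] .
  qed
qed

lemma (in principal_domain) Irr_mset_eq:
  assumes "r \<in> carrier R" "r \<noteq> \<zero>"
    and "set fs \<subseteq> carrier (mult_of R)" "wfactors (mult_of R) fs r"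
  shows "Irr_mset R r = fmset (mult_of R) fs"
  unfolding Irr_mset_def
proof (rule the_equality)
  show "\<exists>fs'. set fs' \<subseteq> carrier (mult_of R) \<and> wfactors (mult_of R) fs' r \<and>
      fmset (mult_of R) fs = fmset (mult_of R) fs'"
    using assms by blast
next
  fix M
  assume "\<exists>fs'. set fs' \<subseteq> carrier (mult_of R) \<and> wfactors (mult_of R) fs' r \<and>
      M = fmset (mult_of R) fs'"
  then obtain fs' where fs': "set fs' \<subseteq> carrier (mult_of R)" "wfactors (mult_of R) fs' r"
    "M = fmset (mult_of R) fs'" by blast
  have "essentially_equal (mult_of R) fs' fs"
    using factorial_domain.axioms(2)[OF factorial_domain_axioms] assms fs'
    by (intro factorial_monoid.wfactors_unique[of "mult_of R" fs' r fs]) auto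
  then show "M = fmset (mult_of R) fs"
    using mult_of.ee_fmset[of fs' fs] fs' assms by auto
qed

end

theory Submission
  imports Defs
begin

text \<open>
  A nonzero submodule of \<open>V\<^sub>p\<close> is an ideal \<open>(c)\<close> of \<open>R\<close> such that \<open>c\<close> divides both \<open>\<sigma>\<^sup>-\<^sup>1(c) p\<close> and
  \<open>\<sigma>(c) q\<close>. Writing \<open>m\<close>, \<open>P\<close>, \<open>Q\<close> for the multiplicity functions of \<open>c\<close>, \<open>p\<close>, \<open>q\<close> on the classes of
  irreducibles, this says \<open>m(z) \<le> m(\<sigma>z) + P(z)\<close> and \<open>m(z) \<le> m(\<sigma>\<^sup>-\<^sup>1z) + Q(z)\<close>.

  If all orbits are infinite, the energy
  \<open>\<Phi>(m) = \<Sum>\<^sub>z m(z) (P(z) + Q(z) - m(z) + m(\<sigma>z))\<close> of such an \<open>m\<close> lies between \<open>0\<close> and \<open>|\<Omega>|\<close>, and it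
  drops strictly when \<open>m\<close> is replaced by a smaller admissible \<open>m'\<close>: if it did not drop, the
  finite nonempty set where \<open>m\<close> and \<open>m'\<close> differ would be closed under \<open>\<sigma>\<^sup>-\<^sup>1\<close>. So a chain of nonzero
  submodules has length at most \<open>|\<Omega>|\<close>, and the zero submodule accounts for one more step.

  If some orbit is finite, multiplying over it gives a nonunit \<open>c\<close> associated to \<open>\<sigma>(c)\<close>, and the
  ideals \<open>(c\<^sup>k)\<close> form an infinite descending chain of submodules.
\<close>

section \<open>Admissible multiplicity functions\<close>

text \<open>The maps induced on \<open>Irr R\<close> by \<sigma> and its inverse are the intended
  \<open>s\<close> and \<open>t\<close>; \<open>aperiodic\<close> says that all orbits are infinite.
  The energy argument uses only this shift structure.\<close>

locale aperiodic_shift =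
  fixes I :: "'c set" and s t :: "'c \<Rightarrow> 'c"
  assumes s_closed [simp, intro]: "z \<in> I \<Longrightarrow> s z \<in> I"
    and t_closed [simp, intro]: "z \<in> I \<Longrightarrow> t z \<in> I"
    and s_t [simp]: "z \<in> I \<Longrightarrow> s (t z) = z"
    and t_s [simp]: "z \<in> I \<Longrightarrow> t (s z) = z"
    and aperiodic: "z \<in> I \<Longrightarrow> 0 < n \<Longrightarrow> (s ^^ n) z \<noteq> z"
begin

lemma t_pow_closed: "z \<in> I \<Longrightarrow> (t ^^ n) z \<in> I"
  by (induction n) auto

lemma s_pow_t_pow: "z \<in> I \<Longrightarrow> (s ^^ n) ((t ^^ n) z) = z"
proof (induction n)
  case (Suc n)
  have "(s ^^ Suc n) ((t ^^ Suc n) z) = (s ^^ n) (s (t ((t ^^ n) z)))"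
    by (metis comp_apply funpow.simps(2) funpow_Suc_right)
  then show ?case using Suc t_pow_closed by simp
qed simp

text \<open>By pigeonhole two iterates of \<open>t\<close> at \<open>z\<close> agree; pushing the
  coincidence forward with a power of \<open>s\<close> exhibits a periodic point, against
  \<open>aperiodic\<close>.\<close>

lemma not_finite_backward_closed:
  assumes "finite E" "E \<subseteq> I" "z \<in> E" and step: "\<And>w. w \<in> E \<Longrightarrow> t w \<in> E"
  shows False
proof -
  have tE: "(t ^^ n) z \<in> E" for n by (induction n) (auto simp: assms)
  have "\<not> inj (\<lambda>n. (t ^^ n) z)"
    using tE assms(1) finite_subset[of "range (\<lambda>n. (t ^^ n) z)" E] by (auto dest: finite_imageD)
  then obtain i j where "i < j" and eq: "(t ^^ i) z = (t ^^ j) z"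
    unfolding inj_def by (metis linorder_neqE_nat)
  let ?w = "(t ^^ i) z"
  have w: "?w \<in> I" using assms t_pow_closed by blast
  have "(t ^^ (j - i + i)) z = (t ^^ (j - i)) ?w" by (simp only: funpow_add comp_apply)
  then have "(t ^^ (j - i)) ?w = (t ^^ j) z" using \<open>i < j\<close> by simp
  then have "(s ^^ (j - i)) ?w = ?w" using s_pow_t_pow[OF w, of "j - i"] eq by simp
  then show False using aperiodic[OF w] \<open>i < j\<close> by simp
qed

text \<open>Reindexing along \<open>s\<close> with inverse \<open>t\<close>. \<open>Z\<close> is not
  assumed invariant: the support condition puts all nonzero terms of both sums inside
  \<open>Z\<close>, and the zero terms are discarded.\<close>

lemma sum_shift:
  fixes f :: "'c \<Rightarrow> int"
  assumes "finite Z" "Z \<subseteq> I" "\<And>z. z \<in> I \<Longrightarrow> f z \<noteq> 0 \<Longrightarrow> z \<in> Z \<and> t z \<in> Z"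
  shows "(\<Sum>z\<in>Z. f (s z)) = (\<Sum>z\<in>Z. f z)"
proof (rule sum.reindex_bij_witness_not_neutral[where i = t and j = s
      and S' = "{z \<in> Z. f (s z) = 0}" and T' = "{z \<in> Z. f z = 0}"])
  show "s z \<in> Z - {z \<in> Z. f z = 0}" if "z \<in> Z - {z \<in> Z. f (s z) = 0}" for z
    using that assms by auto
qed (use assms in auto)

definition admissible :: "('c \<Rightarrow> int) \<Rightarrow> ('c \<Rightarrow> int) \<Rightarrow> ('c \<Rightarrow> int) \<Rightarrow> bool" where
  "admissible P Q m \<longleftrightarrow> finite {z. m z \<noteq> 0} \<and> {z. m z \<noteq> 0} \<subseteq> I \<and>
     (\<forall>z. 0 \<le> m z) \<and> (\<forall>z\<in>I. m z \<le> m (s z) + P z \<and> m z \<le> m (t z) + Q z)"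

text \<open>The finite window \<open>Z\<close> stands for all of \<open>I\<close>: once it contains
  the support of \<open>m\<close>, the value no longer depends on it. Reindexing also asks for the
  translate of the support under \<open>t\<close>.\<close>

definition energy :: "('c \<Rightarrow> int) \<Rightarrow> ('c \<Rightarrow> int) \<Rightarrow> 'c set \<Rightarrow> ('c \<Rightarrow> int) \<Rightarrow> int" where
  "energy P Q Z m = (\<Sum>z\<in>Z. m z * (P z + Q z - m z + m (s z)))"

lemma energy_nonneg:
  assumes "admissible P Q m" "Z \<subseteq> I" "\<And>z. 0 \<le> Q z"
  shows "0 \<le> energy P Q Z m"
  unfolding energy_def
proof (intro sum_nonneg mult_nonneg_nonneg)
  fix z assume "z \<in> Z"
  then have "m z \<le> m (s z) + P z" using assms by (auto simp: admissible_def)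
  then show "0 \<le> P z + Q z - m z + m (s z)" using assms(3)[of z] by simp
qed (use assms in \<open>auto simp: admissible_def\<close>)

text \<open>Polarizing the quadratic terms and reindexing writes twice the energy difference as the
  sum of \<open>e z * (D z + F z)\<close> with \<open>e = m - m'\<close>. Here \<open>D\<close> and
  \<open>F\<close> add, over \<open>m\<close> and \<open>m'\<close>, the slacks of the two
  admissibility inequalities, so no summand is negative, and a zero sum would propagate
  \<open>e \<noteq> 0\<close> along \<open>t\<close> forever.\<close>

lemma energy_strict_mono:
  assumes m: "admissible P Q m" and m': "admissible P Q m'"
    and le: "\<And>z. m' z \<le> m z" and ne: "m' \<noteq> m"
    and Z: "finite Z" "Z \<subseteq> I" "\<And>z. m z \<noteq> 0 \<Longrightarrow> z \<in> Z \<and> t z \<in> Z"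
  shows "energy P Q Z m' < energy P Q Z m"
proof -
  define e where "e z = m z - m' z" for z
  define D where "D z = 2 * Q z - (m z - m (t z)) - (m' z - m' (t z))" for z
  define F where "F z = 2 * P z + (m (s z) - m z) + (m' (s z) - m' z)" for z
  have m'0: "m' z \<noteq> 0 \<Longrightarrow> m z \<noteq> 0" for z
    using le[of z] m' unfolding admissible_def by (metis dual_order.antisym)
  have e0: "e z \<noteq> 0 \<Longrightarrow> m z \<noteq> 0" for z unfolding e_def using m'0 by force
  have e_nonneg: "0 \<le> e z" for z using le by (simp add: e_def)
  have D: "0 \<le> D z" and F: "0 \<le> F z" if "z \<in> I" for z
  proof -
    have "m z \<le> m (s z) + P z" "m z \<le> m (t z) + Q z" "m' z \<le> m' (s z) + P z" "m' z \<le> m' (t z) + Q z"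
      using that m m' by (auto simp: admissible_def)
    then show "0 \<le> D z" "0 \<le> F z" by (simp_all add: D_def F_def)
  qed
  have 1: "(\<Sum>z\<in>Z. e (s z) * m z) = (\<Sum>z\<in>Z. e z * m (t z))"
    using sum_shift[of Z "\<lambda>z. e z * m (t z)"] Z e0 by (auto simp: subset_iff)
  have 2: "(\<Sum>z\<in>Z. e (s z) * m' z) = (\<Sum>z\<in>Z. e z * m' (t z))"
    using sum_shift[of Z "\<lambda>z. e z * m' (t z)"] Z e0 by (auto simp: subset_iff)
  \<comment> \<open>Doubling permits the symmetric split 2(xy - x'y') = (x - x')(y + y') + (x +
    x')(y - y') with x = \<open>m z\<close>, y = \<open>m (s z)\<close> and likewise for
    \<open>m'\<close>.\<close>
  have "2 * (energy P Q Z m - energy P Q Z m')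
      = (\<Sum>z\<in>Z. e z * (2 * P z + 2 * Q z - 2 * (m z + m' z) + m (s z) + m' (s z)))
        + (\<Sum>z\<in>Z. e (s z) * m z) + (\<Sum>z\<in>Z. e (s z) * m' z)"
    unfolding energy_def e_def
    by (simp add: sum_distrib_left algebra_simps flip: sum.distrib sum_subtractf)
  also have "\<dots> = (\<Sum>z\<in>Z. e z * (D z + F z))"
    unfolding 1 2 sum.distrib[symmetric]
    by (rule sum.cong) (simp_all add: D_def F_def algebra_simps)
  also have "\<dots> > 0"
  proof (rule ccontr)
    assume "\<not> 0 < (\<Sum>z\<in>Z. e z * (D z + F z))"
    have nn: "0 \<le> e z * (D z + F z)" if "z \<in> Z" for z
      using that Z e_nonneg[of z] D[of z] F[of z] by auto
    have "0 \<le> (\<Sum>z\<in>Z. e z * (D z + F z))" using nn by (rule sum_nonneg)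
    then have "(\<Sum>z\<in>Z. e z * (D z + F z)) = 0"
      using \<open>\<not> 0 < (\<Sum>z\<in>Z. e z * (D z + F z))\<close> by linarith
    then have zero: "e z * (D z + F z) = 0" if "z \<in> Z" for z
      using sum_nonneg_eq_0_iff[OF Z(1), of "\<lambda>z. e z * (D z + F z)"] nn that by simp
    let ?E = "{z. e z \<noteq> 0}"
    have EI: "?E \<subseteq> Z" using e0 Z by blast
    obtain z where "e z \<noteq> 0" using ne unfolding e_def by fastforce
    moreover have "e (t w) \<noteq> 0" if "e w \<noteq> 0" for w
    proof -
      have w: "w \<in> I" using that EI Z by blast
      have "D w + F w = 0" using zero[of w] that EI by auto
      then have "D w = 0" using D[OF w] F[OF w] by linarith
      moreover have "m w \<le> m (t w) + Q w" "m' w \<le> m' (t w) + Q w"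
        using w m m' by (auto simp: admissible_def)
      \<comment> \<open>\<open>D w\<close> is the sum of two nonnegative slacks, so both vanish:
        \<open>m\<close> and \<open>m'\<close> drop by the same amount \<open>Q w\<close> from
        \<open>w\<close> to \<open>t w\<close>.\<close>
      ultimately have "e w = e (t w)" unfolding D_def e_def by linarith
      then show ?thesis using that by simp
    qed
    ultimately show False
      using not_finite_backward_closed[of ?E z] EI Z finite_subset by blast
  qed
  finally show ?thesis by simp
qed

text \<open>\<open>U\<close> accumulates \<open>Q\<close> backwards along the orbit, and
  \<open>f = U - m\<close> turns out nonnegative. Two reindexings rewrite the energy as the sum of
  \<open>P z * m z + (m z - m (s z)) * f z\<close>; bounding \<open>m z - m (s z)\<close> by
  \<open>P z\<close> leaves \<open>P z * (m z + f z)\<close>, which is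
  \<open>P z * U z\<close>.\<close>

lemma energy_le:
  assumes m: "admissible P Q m" and U: "\<And>z. 0 \<le> U z" "\<And>z. z \<in> I \<Longrightarrow> U z = U (t z) + Q z"
    and Z: "finite Z" "Z \<subseteq> I" "\<And>z. m z \<noteq> 0 \<Longrightarrow> z \<in> Z \<and> t z \<in> Z"
  shows "energy P Q Z m \<le> (\<Sum>z\<in>Z. P z * U z)"
proof -
  define f where "f z = U z - m z" for z
  have f_le: "f (t z) \<le> f z" if "z \<in> I" for z
    using that m U(2)[of z] by (auto simp: f_def admissible_def)
  have f: "0 \<le> f z" if "z \<in> I" for z
  proof (rule ccontr)
    assume "\<not> 0 \<le> f z"
    \<comment> \<open>Where \<open>f\<close> is negative, \<open>m\<close> exceeds \<open>U\<close>
      and is nonzero, so \<open>?E\<close> is finite; \<open>f_le\<close> closes it under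
      \<open>t\<close>.\<close>
    let ?E = "{w \<in> I. f w < 0}"
    have "?E \<subseteq> {w. m w \<noteq> 0}"
    proof
      fix w assume "w \<in> ?E"
      then show "w \<in> {w. m w \<noteq> 0}" using U(1)[of w] by (auto simp: f_def)
    qed
    then have "finite ?E" using m finite_subset by (auto simp: admissible_def)
    moreover have "t w \<in> ?E" if "w \<in> ?E" for w using that f_le[of w] by auto
    ultimately show False
      using not_finite_backward_closed[of ?E z] \<open>\<not> 0 \<le> f z\<close> that by auto
  qed
  have 1: "(\<Sum>z\<in>Z. m (s z) * m z) = (\<Sum>z\<in>Z. m z * m (t z))"
    using sum_shift[of Z "\<lambda>z. m z * m (t z)"] Z by (auto simp: subset_iff)
  have 2: "(\<Sum>z\<in>Z. m (s z) * f z) = (\<Sum>z\<in>Z. m z * f (t z))"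
    using sum_shift[of Z "\<lambda>z. m z * f (t z)"] Z by (auto simp: subset_iff)
  have "energy P Q Z m = (\<Sum>z\<in>Z. m z * P z + m z * Q z - m z * m z) + (\<Sum>z\<in>Z. m (s z) * m z)"
    unfolding energy_def by (simp add: algebra_simps flip: sum.distrib)
  also have "\<dots> = (\<Sum>z\<in>Z. P z * m z + m z * f z) - (\<Sum>z\<in>Z. m z * f (t z))"
    unfolding 1 sum.distrib[symmetric] sum_subtractf[symmetric]
  proof (rule sum.cong)
    fix z assume "z \<in> Z"
    then have U_eq: "U z = U (t z) + Q z" using U(2)[of z] Z by auto
    then show "m z * P z + m z * Q z - m z * m z + m z * m (t z) = P z * m z + m z * f z - m z * f (t z)"
      unfolding f_def U_eq by (simp add: algebra_simps)
  qed simp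
  also have "\<dots> = (\<Sum>z\<in>Z. P z * m z + (m z - m (s z)) * f z)"
    unfolding 2[symmetric] by (simp add: algebra_simps flip: sum.distrib sum_subtractf)
  also have "\<dots> \<le> (\<Sum>z\<in>Z. P z * U z)"
  proof (rule sum_mono)
    fix z assume "z \<in> Z"
    then have "z \<in> I" using Z by blast
    then have "m z - m (s z) \<le> P z" using m by (fastforce simp: admissible_def)
    then have "(m z - m (s z)) * f z \<le> P z * f z" using f[OF \<open>z \<in> I\<close>] by (rule mult_right_mono)
    then show "P z * m z + (m z - m (s z)) * f z \<le> P z * U z" by (simp add: f_def algebra_simps)
  qed
  finally show ?thesis .
qed

text \<open>The energy is an integer that loses at least 1 at each of the \<open>k\<close> steps,
  ends nonnegative and starts no higher than the sum on the right.\<close>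

lemma admissible_chain_length:
  assumes adm: "\<And>i. i \<le> k \<Longrightarrow> admissible P Q (M i)"
    and dec: "\<And>i. i < k \<Longrightarrow> M (Suc i) \<le> M i \<and> M (Suc i) \<noteq> M i"
    and U: "\<And>z. 0 \<le> U z" "\<And>z. z \<in> I \<Longrightarrow> U z = U (t z) + Q z"
    and Q: "\<And>z. 0 \<le> Q z"
  obtains Z where "finite Z" "Z \<subseteq> I" "int k \<le> (\<Sum>z\<in>Z. P z * U z)"
proof
  let ?S = "{z. M 0 z \<noteq> 0}" and ?E = "energy P Q"
  \<comment> \<open>\<open>M 0\<close> dominates the whole sequence, so one window built from its
    support serves every \<open>M i\<close>.\<close>
  let ?Z = "?S \<union> t ` ?S"
  have M0: "finite ?S" "?S \<subseteq> I" using adm[of 0] by (auto simp: admissible_def)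
  show Z: "finite ?Z" "?Z \<subseteq> I" using M0 by auto
  have le: "i \<le> k \<Longrightarrow> M i \<le> M 0" for i
  proof (induction i)
    case (Suc i)
    then have "M (Suc i) \<le> M i" "M i \<le> M 0" using dec[of i] by auto
    then show ?case by (rule order_trans)
  qed simp
  have supp: "M i z \<noteq> 0 \<Longrightarrow> M 0 z \<noteq> 0" if "i \<le> k" for i z
    using le_funD[OF le[OF that], of z] adm[OF that] unfolding admissible_def
    by (metis dual_order.antisym)
  have "int i \<le> ?E ?Z (M 0) - ?E ?Z (M i)" if "i \<le> k" for i
    using that
  proof (induction i)
    case (Suc i)
    have "?E ?Z (M (Suc i)) < ?E ?Z (M i)"
      using Suc.prems adm[of i] adm[of "Suc i"] dec[of i] supp[of i] Z
      by (intro energy_strict_mono) (auto simp: le_fun_def)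
    then show ?case using Suc by simp
  qed simp
  from this[of k] have "int k \<le> ?E ?Z (M 0)"
    using energy_nonneg[OF adm[of k] Z(2) Q] by simp
  also have "\<dots> \<le> (\<Sum>z\<in>?Z. P z * U z)"
    using adm[of 0] Z U by (intro energy_le) auto
  finally show "int k \<le> (\<Sum>z\<in>?Z. P z * U z)" .
qed

end

section \<open>Multisets of irreducible factors\<close>

context principal_domain
begin

lemma wfactors_obtain:
  assumes "c \<in> carrier R" "c \<noteq> \<zero>"
  obtains fs where "set fs \<subseteq> carrier (mult_of R)" "wfactors (mult_of R) fs c"
    "Irr_mset R c = fmset (mult_of R) fs"
proof -
  obtain fs where "set fs \<subseteq> carrier (mult_of R)" "wfactors (mult_of R) fs c"
    using mult_of.wfactors_exist[of c] assms by auto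
  then show thesis using that Irr_mset_eq[OF assms] by blast
qed

lemma Irr_mset_mult:
  assumes "c \<in> carrier R" "c \<noteq> \<zero>" "d \<in> carrier R" "d \<noteq> \<zero>"
  shows "Irr_mset R (c \<otimes> d) = Irr_mset R c + Irr_mset R d"
proof -
  obtain fs where fs: "set fs \<subseteq> carrier (mult_of R)" "wfactors (mult_of R) fs c"
    "Irr_mset R c = fmset (mult_of R) fs" using wfactors_obtain[OF assms(1,2)] .
  obtain gs where gs: "set gs \<subseteq> carrier (mult_of R)" "wfactors (mult_of R) gs d"
    "Irr_mset R d = fmset (mult_of R) gs" using wfactors_obtain[OF assms(3,4)] .
  have "wfactors (mult_of R) (fs @ gs) (c \<otimes> d)"
    using mult_of.wfactors_mult[OF fs(2) gs(2)] assms fs(1) gs(1) by simp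
  then have "Irr_mset R (c \<otimes> d) = fmset (mult_of R) (fs @ gs)"
    using assms fs(1) gs(1) by (intro Irr_mset_eq) (auto simp: integral_iff)
  then show ?thesis using fs gs by (simp add: fmset_def)
qed

text \<open>Unique factorization; divisibility in \<open>mult_of R\<close> and in \<open>R\<close>
  agree on nonzero elements. This is how ideal containment becomes an order on
  multiplicities.\<close>

lemma Irr_mset_subset_iff:
  assumes "c \<in> carrier R" "c \<noteq> \<zero>" "d \<in> carrier R" "d \<noteq> \<zero>"
  shows "Irr_mset R c \<subseteq># Irr_mset R d \<longleftrightarrow> c divides d"
proof -
  obtain fs where fs: "set fs \<subseteq> carrier (mult_of R)" "wfactors (mult_of R) fs c"
    "Irr_mset R c = fmset (mult_of R) fs" using wfactors_obtain[OF assms(1,2)] .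
  obtain gs where gs: "set gs \<subseteq> carrier (mult_of R)" "wfactors (mult_of R) gs d"
    "Irr_mset R d = fmset (mult_of R) gs" using wfactors_obtain[OF assms(3,4)] .
  have cd: "c \<in> carrier (mult_of R)" "d \<in> carrier (mult_of R)" using assms by auto
  have "c divides\<^bsub>mult_of R\<^esub> d \<longleftrightarrow> Irr_mset R c \<subseteq># Irr_mset R d"
    unfolding fs(3) gs(3) by (rule mult_of.divides_as_fmsubset[OF fs(2) gs(2) cd fs(1) gs(1)])
  moreover have "c divides\<^bsub>mult_of R\<^esub> d \<longleftrightarrow> c divides d"
    using divides_imp_divides_mult[of c d] assms by (blast intro: divides_mult_imp_divides)
  ultimately show ?thesis by blast
qed

lemma set_Irr_mset:
  assumes "c \<in> carrier R" "c \<noteq> \<zero>"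
  shows "set_mset (Irr_mset R c) \<subseteq> Irr R"
proof -
  obtain fs where fs: "set fs \<subseteq> carrier (mult_of R)" "wfactors (mult_of R) fs c"
    "Irr_mset R c = fmset (mult_of R) fs" using wfactors_obtain[OF assms] .
  then have "ring_irreducible f" if "f \<in> set fs" for f
    using that ring_irreducibleI'[of f] by (auto simp: wfactors_def)
  then show ?thesis using fs by (auto simp: fmset_def Irr_def assoc_class_def)
qed

end

section \<open>Transport of irreducible factors along \<sigma>\<close>

lemma count_image_mset_inj_on:
  assumes "inj_on f I" "set_mset M \<subseteq> I" "z \<in> I"
  shows "count (image_mset f M) (f z) = count M z"
  using assms(2)
proof (induction M)
  case (add x M)
  then show ?case using assms(1,3) by (auto dest: inj_onD)
qed simp

locale gwa_V_pid = gwa_V_data R \<sigma> a p b q + principal_domain R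
  for R (structure) and \<sigma> a p b q +
  assumes a_nonzero: "a \<noteq> \<zero>"
begin

lemma \<sigma>_zero [simp]: "\<sigma> \<zero> = \<zero>"
  using \<sigma>_hom(1)[of \<zero> \<zero>] by (simp add: add.r_cancel_one')

lemma \<sigma>_eq_zero_iff [simp]: "c \<in> carrier R \<Longrightarrow> \<sigma> c = \<zero> \<longleftrightarrow> c = \<zero>"
  using \<tau>_\<sigma>[of c] \<tau>_\<sigma>[of \<zero>] by (metis \<sigma>_zero zero_closed)

lemma \<tau>_eq_zero_iff [simp]: "c \<in> carrier R \<Longrightarrow> \<tau> c = \<zero> \<longleftrightarrow> c = \<zero>"
  using \<sigma>_eq_zero_iff[of "\<tau> c"] by simp

lemma \<tau>_one [simp]: "\<tau> \<one> = \<one>"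
  using \<tau>_\<sigma>[of \<one>] by simp

lemma p_nonzero: "p \<noteq> \<zero>" and b_nonzero: "b \<noteq> \<zero>"
  using a_nonzero a_eq by auto

lemma q_nonzero: "q \<noteq> \<zero>"
  using b_nonzero by (simp add: q_eq)

lemma \<sigma>_Units: "u \<in> Units R \<Longrightarrow> \<sigma> u \<in> Units R"
  by (metis Units_closed Units_r_inv_ex \<sigma>_closed \<sigma>_hom(2,3) divides_one dividesI)

lemma \<tau>_Units: "u \<in> Units R \<Longrightarrow> \<tau> u \<in> Units R"
  by (metis Units_closed Units_r_inv_ex \<tau>_closed \<tau>_hom(2) \<tau>_one divides_one dividesI)

lemma ring_irreducible_\<sigma>:
  assumes "r \<in> carrier R" "ring_irreducible r" shows "ring_irreducible (\<sigma> r)"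
proof (rule ring_irreducibleI)
  show "\<sigma> r \<in> carrier R - {\<zero>}" using assms ring_irreducibleE(1)[OF assms] by simp
  show "\<sigma> r \<notin> Units R" using \<tau>_Units[of "\<sigma> r"] assms(1) ring_irreducibleE(4)[OF assms] by auto
next
  fix c d assume cd: "c \<in> carrier R" "d \<in> carrier R" "\<sigma> r = c \<otimes> d"
  then have "r = \<tau> c \<otimes> \<tau> d" using \<tau>_\<sigma>[OF assms(1)] by simp
  then have "\<tau> c \<in> Units R \<or> \<tau> d \<in> Units R" using ring_irreducibleE(5)[OF assms] cd by simp
  then show "c \<in> Units R \<or> d \<in> Units R" using \<sigma>_Units[of "\<tau> c"] \<sigma>_Units[of "\<tau> d"] cd by auto
qed

lemma ring_irreducible_\<tau>:
  assumes "r \<in> carrier R" "ring_irreducible r" shows "ring_irreducible (\<tau> r)"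
proof (rule ring_irreducibleI)
  show "\<tau> r \<in> carrier R - {\<zero>}" using assms ring_irreducibleE(1)[OF assms] by simp
  show "\<tau> r \<notin> Units R" using \<sigma>_Units[of "\<tau> r"] assms(1) ring_irreducibleE(4)[OF assms] by auto
next
  fix c d assume cd: "c \<in> carrier R" "d \<in> carrier R" "\<tau> r = c \<otimes> d"
  then have "r = \<sigma> c \<otimes> \<sigma> d" using \<sigma>_\<tau>[OF assms(1)] by (metis \<sigma>_hom(2))
  then have "\<sigma> c \<in> Units R \<or> \<sigma> d \<in> Units R" using ring_irreducibleE(5)[OF assms] cd by simp
  then show "c \<in> Units R \<or> d \<in> Units R" using \<tau>_Units[of "\<sigma> c"] \<tau>_Units[of "\<sigma> d"] cd by auto
qed

lemma \<sigma>_image_assoc_class: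
  "r \<in> carrier R \<Longrightarrow> r \<noteq> \<zero> \<Longrightarrow> \<sigma> ` assoc_class R r = assoc_class R (\<sigma> r)"
  using image_assoc_class[OF \<sigma>_aut] .

lemma IrrE:
  assumes "z \<in> Irr R"
  obtains r where "r \<in> carrier R" "r \<noteq> \<zero>" "ring_irreducible r" "z = assoc_class R r"
  using assms ring_irreducibleE(1) unfolding Irr_def by blast

lemma IrrI: "r \<in> carrier R \<Longrightarrow> ring_irreducible r \<Longrightarrow> assoc_class R r \<in> Irr R"
  by (auto simp: Irr_def)

lemma Irr_subset_carrier: "z \<in> Irr R \<Longrightarrow> z \<subseteq> carrier R"
  by (auto simp: Irr_def assoc_class_def eq_closure_of_def)

lemma \<sigma>_Irr: "z \<in> Irr R \<Longrightarrow> \<sigma> ` z \<in> Irr R"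
  by (elim IrrE) (auto simp: \<sigma>_image_assoc_class intro!: IrrI ring_irreducible_\<sigma>)

lemma \<sigma>_\<tau>_image: "z \<subseteq> carrier R \<Longrightarrow> \<sigma> ` \<tau> ` z = z"
  by (force simp: image_image image_iff subset_iff)

lemma \<tau>_\<sigma>_image: "z \<subseteq> carrier R \<Longrightarrow> \<tau> ` \<sigma> ` z = z"
  by (force simp: image_image image_iff subset_iff)

lemma \<tau>_Irr:
  assumes "z \<in> Irr R" shows "\<tau> ` z \<in> Irr R"
proof -
  obtain r where r: "r \<in> carrier R" "r \<noteq> \<zero>" "ring_irreducible r" "z = assoc_class R r"
    using assms by (rule IrrE)
  have cls: "assoc_class R (\<tau> r) \<in> Irr R" using r by (intro IrrI ring_irreducible_\<tau>) auto
  have "z = \<sigma> ` assoc_class R (\<tau> r)" using r by (simp add: \<sigma>_image_assoc_class)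
  then have "\<tau> ` z = assoc_class R (\<tau> r)" using \<tau>_\<sigma>_image[OF Irr_subset_carrier[OF cls]] by simp
  then show ?thesis using cls by simp
qed

lemma inj_on_\<sigma>_image: "inj_on ((`) \<sigma>) (Irr R)"
  by (rule inj_on_inverseI[of _ "(`) \<tau>"]) (simp add: \<tau>_\<sigma>_image Irr_subset_carrier)

text \<open>The images of the factors of \<open>c\<close> are irreducible and multiply to \<sigma> c
  up to the unit \<sigma> u, hence form a factorization of \<sigma> c; taking classes commutes with
  \<sigma>.\<close>

lemma Irr_mset_\<sigma>:
  assumes "c \<in> carrier R" "c \<noteq> \<zero>"
  shows "Irr_mset R (\<sigma> c) = image_mset ((`) \<sigma>) (Irr_mset R c)"
proof -
  obtain fs where fs: "set fs \<subseteq> carrier (mult_of R)" "wfactors (mult_of R) fs c"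
    "Irr_mset R c = fmset (mult_of R) fs" using wfactors_obtain[OF assms] .
  have foldr_closed: "set gs \<subseteq> carrier R \<Longrightarrow> foldr (\<otimes>) gs \<one> \<in> carrier R" for gs
    by (induction gs) auto
  have foldr_\<sigma>: "set gs \<subseteq> carrier R \<Longrightarrow> foldr (\<otimes>) (map \<sigma> gs) \<one> = \<sigma> (foldr (\<otimes>) gs \<one>)" for gs
    by (induction gs) (auto simp: foldr_closed)
  have fsR: "set fs \<subseteq> carrier R" using fs(1) by auto
  then have \<sigma>fs: "set (map \<sigma> fs) \<subseteq> carrier R" by auto
  have "foldr (\<otimes>) fs \<one> \<sim> c"
    using fs(2) assoc_iff_assoc_mult[OF foldr_closed[OF fsR] assms(1)] by (simp add: wfactors_def)
  then obtain u where u: "u \<in> Units R" "foldr (\<otimes>) fs \<one> = u \<otimes> c"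
    using ring_associated_iff[OF foldr_closed[OF fsR] assms(1)] by blast
  have "foldr (\<otimes>) (map \<sigma> fs) \<one> = \<sigma> u \<otimes> \<sigma> c"
    using u assms by (simp add: foldr_\<sigma>[OF fsR] Units_closed)
  then have "foldr (\<otimes>) (map \<sigma> fs) \<one> \<sim> \<sigma> c"
    using u assms \<sigma>_Units[OF u(1)] by (subst ring_associated_iff) (auto simp: Units_closed)
  then have "foldr (\<otimes>) (map \<sigma> fs) \<one> \<sim>\<^bsub>mult_of R\<^esub> \<sigma> c"
    using assoc_iff_assoc_mult[OF foldr_closed[OF \<sigma>fs] \<sigma>_closed[OF assms(1)]] by blast
  moreover have "irreducible (mult_of R) (\<sigma> f)" if "f \<in> set fs" for f
  proof -
    have "ring_irreducible f" using that fs ring_irreducibleI'[of f] by (auto simp: wfactors_def)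
    then show ?thesis using that fsR ring_irreducible_\<sigma>[of f] ring_irreducibleE(3)[of "\<sigma> f"] by auto
  qed
  ultimately have "wfactors (mult_of R) (map \<sigma> fs) (\<sigma> c)" by (auto simp: wfactors_def)
  moreover have "set (map \<sigma> fs) \<subseteq> carrier (mult_of R)" using fs(1) by auto
  ultimately have "Irr_mset R (\<sigma> c) = fmset (mult_of R) (map \<sigma> fs)"
    using assms by (intro Irr_mset_eq) auto
  also have "\<dots> = image_mset ((`) \<sigma>) (fmset (mult_of R) fs)"
  proof -
    have "map (assocs (mult_of R)) (map \<sigma> fs) = map ((`) \<sigma>) (map (assocs (mult_of R)) fs)"
      using fs(1) \<sigma>_image_assoc_class by (auto simp: assoc_class_def subset_iff)
    then show ?thesis by (simp only: fmset_def mset_map)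
  qed
  finally show ?thesis using fs(3) by simp
qed

lemma count_Irr_mset_\<sigma>:
  assumes "c \<in> carrier R" "c \<noteq> \<zero>" "z \<in> Irr R"
  shows "count (Irr_mset R (\<sigma> c)) (\<sigma> ` z) = count (Irr_mset R c) z"
  using count_image_mset_inj_on[OF inj_on_\<sigma>_image set_Irr_mset assms(3)] assms
  by (simp add: Irr_mset_\<sigma>)

text \<open>Together with \<open>count_Irr_mset_\<tau>\<close> this fixes the direction of the
  shift: applying \<sigma> to an element evaluates its multiplicities at the preimage class,
  applying \<tau> at the image class.\<close>

lemma count_Irr_mset_\<sigma>':
  assumes "c \<in> carrier R" "c \<noteq> \<zero>" "z \<in> Irr R"
  shows "count (Irr_mset R (\<sigma> c)) z = count (Irr_mset R c) (\<tau> ` z)"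
  using count_Irr_mset_\<sigma>[OF assms(1,2) \<tau>_Irr[OF assms(3)]]
  by (simp add: \<sigma>_\<tau>_image Irr_subset_carrier assms(3))

lemma count_Irr_mset_\<tau>:
  assumes "c \<in> carrier R" "c \<noteq> \<zero>" "z \<in> Irr R"
  shows "count (Irr_mset R (\<tau> c)) z = count (Irr_mset R c) (\<sigma> ` z)"
  using count_Irr_mset_\<sigma>[of "\<tau> c" z] assms by simp

end

section \<open>Counting pairs with multiplicity\<close>

text \<open>Grouping by the second component turns the size of \<open>Omega\<close> into a sum, over
  the factors of \<open>p\<close>, of the number of factors of \<open>q\<close> that precede
  them.\<close>

lemma size_filter_pairs:
  "size {#(z, w) \<in># (\<Sum>z\<in>#A. {#(z, w). w \<in># B#}). P z w#}
    = (\<Sum>w\<in>#B. size {#z \<in># A. P z w#})"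
proof (induction A)
  case (add x A)
  have "size {#(z, w) \<in># {#(x, w). w \<in># B#}. P z w#} = (\<Sum>w\<in>#B. if P x w then 1 else 0)"
    by (induction B) auto
  moreover have "(\<Sum>w\<in>#B. size {#z \<in># add_mset x A. P z w#})
      = (\<Sum>w\<in>#B. if P x w then 1 else 0) + (\<Sum>w\<in>#B. size {#z \<in># A. P z w#})"
    unfolding sum_mset.distrib[symmetric] by (intro arg_cong[of _ _ sum_mset] image_mset_cong) auto
  ultimately show ?case using add by simp
qed simp

text \<open>Only an inequality, since \<open>Z\<close> is the window of the energy bound and may
  miss elements of \<open>B\<close>.\<close>

lemma sum_count_mult_le_sum_mset:
  fixes f :: "'c \<Rightarrow> nat"
  assumes "finite Z"
  shows "(\<Sum>z\<in>Z. count B z * f z) \<le> (\<Sum>w\<in>#B. f w)"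
proof (induction B)
  case (add x B)
  have "(\<Sum>z\<in>Z. count (add_mset x B) z * f z)
      = (\<Sum>z\<in>Z. (if z = x then f x else 0) + count B z * f z)"
    by (intro sum.cong) auto
  also have "\<dots> \<le> f x + (\<Sum>z\<in>Z. count B z * f z)"
    using assms by (simp add: sum.distrib)
  finally show ?case using add by simp
qed simp

context gwa_V_pid
begin

abbreviation "A \<equiv> gwa R \<sigma> a"
abbreviation "V \<equiv> gwa_V R \<sigma> p q"
abbreviation "s \<equiv> (`) \<sigma>"

section \<open>Orbits\<close>

lemma s_pow_Irr: "z \<in> Irr R \<Longrightarrow> (s ^^ n) z \<in> Irr R"
  by (induction n) (auto intro: \<sigma>_Irr)

lemma \<sigma>_Bij: "\<sigma> \<in> Bij (carrier R)"
  using \<sigma>_aut by (simp add: ring_AutoGroup_def)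

lemma ring_AutoGroup_inv: "inv\<^bsub>ring_AutoGroup R\<^esub> \<sigma> = restrict \<tau> (carrier R)"
  unfolding m_inv_def
proof (rule the_equality)
  have \<tau>: "restrict \<tau> (carrier R) \<in> Bij (carrier R)" using \<sigma>_Bij by (rule restrict_inv_into_Bij)
  moreover have "restrict \<tau> (carrier R) \<in> ring_hom R R"
    by (auto simp: ring_hom_def)
  moreover have "compose (carrier R) \<sigma> (restrict \<tau> (carrier R)) = (\<lambda>x\<in>carrier R. x)"
    "compose (carrier R) (restrict \<tau> (carrier R)) \<sigma> = (\<lambda>x\<in>carrier R. x)"
    by (auto simp: compose_def)
  ultimately show "restrict \<tau> (carrier R) \<in> carrier (ring_AutoGroup R) \<and>
      \<sigma> \<otimes>\<^bsub>ring_AutoGroup R\<^esub> restrict \<tau> (carrier R) = \<one>\<^bsub>ring_AutoGroup R\<^esub> \<and>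
      restrict \<tau> (carrier R) \<otimes>\<^bsub>ring_AutoGroup R\<^esub> \<sigma> = \<one>\<^bsub>ring_AutoGroup R\<^esub>"
    using \<sigma>_Bij by (simp add: ring_AutoGroup_def BijGroup_def)
next
  fix y assume "y \<in> carrier (ring_AutoGroup R) \<and>
      \<sigma> \<otimes>\<^bsub>ring_AutoGroup R\<^esub> y = \<one>\<^bsub>ring_AutoGroup R\<^esub> \<and>
      y \<otimes>\<^bsub>ring_AutoGroup R\<^esub> \<sigma> = \<one>\<^bsub>ring_AutoGroup R\<^esub>"
  then have y: "y \<in> Bij (carrier R)" "compose (carrier R) y \<sigma> = (\<lambda>x\<in>carrier R. x)"
    using \<sigma>_Bij by (auto simp: ring_AutoGroup_def BijGroup_def)
  \<comment> \<open>Evaluating the left inverse law at \<tau> x determines \<open>y\<close> on the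
    carrier; extensionality settles the rest.\<close>
  have "y x = \<tau> x" if "x \<in> carrier R" for x
    using fun_cong[OF y(2), of "\<tau> x"] that by (simp add: compose_def)
  then show "y = restrict \<tau> (carrier R)"
    using Bij_imp_extensional[OF y(1)] by (intro extensionalityI) auto
qed

lemma ring_AutoGroup_one: "\<one>\<^bsub>ring_AutoGroup R\<^esub> = (\<lambda>x\<in>carrier R. x)"
  by (simp add: ring_AutoGroup_def BijGroup_def)

text \<open>Induction over the generated group. Membership in \<open>Bij\<close> is carried along
  because the group product is \<open>compose\<close> only on such maps.\<close>

lemma generate_image_closed:
  assumes "g \<in> generate (ring_AutoGroup R) {\<sigma>}"
    and F: "F \<subseteq> Pow (carrier R)" "\<And>w. w \<in> F \<Longrightarrow> \<sigma> ` w \<in> F" "\<And>w. w \<in> F \<Longrightarrow> \<tau> ` w \<in> F"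
  shows "g \<in> Bij (carrier R) \<and> (\<forall>w\<in>F. g ` w \<in> F)"
  using assms(1)
proof (induction rule: generate.induct)
  case one
  have "(\<lambda>x\<in>carrier R. x) ` w = w" if "w \<in> F" for w
    using that F(1) by (force simp: subset_iff image_iff)
  then show ?case
    unfolding ring_AutoGroup_one using id_Bij[of "carrier R"] by (metis (no_types, lifting))
next
  case (incl h)
  then show ?case using F \<sigma>_Bij by auto
next
  case (inv h)
  have "restrict \<tau> (carrier R) ` w = \<tau> ` w" if "w \<in> F" for w
    using that F(1) by (intro image_cong) auto
  moreover have "h = \<sigma>" using inv by simp
  ultimately show ?case
    using F(3) restrict_inv_into_Bij[OF \<sigma>_Bij] by (metis ring_AutoGroup_inv)
next
  case (eng h1 h2)
  have eq: "h1 \<otimes>\<^bsub>ring_AutoGroup R\<^esub> h2 = compose (carrier R) h1 h2"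
    using eng by (simp add: ring_AutoGroup_def BijGroup_def)
  have "compose (carrier R) h1 h2 ` w = h1 ` h2 ` w" if "w \<in> F" for w
    using that F(1) unfolding image_image by (intro image_cong) (auto simp: compose_def)
  then show ?case using eng eq by (auto intro: compose_Bij)
qed

lemma carrier_generated:
  "carrier (subgroup_generated (ring_AutoGroup R) {\<sigma>}) = generate (ring_AutoGroup R) {\<sigma>}"
  using \<sigma>_aut by (simp add: subgroup_generated_def)

text \<open>The forward iterates of a periodic class form a finite set stable under the whole group.
  Conversely, a finite orbit contains all forward iterates, so two coincide, and cancelling the
  injective shift leaves a period.\<close>

lemma finite_orbit_iff:
  assumes z: "z \<in> Irr R"
  shows "finite (orbit (subgroup_generated (ring_AutoGroup R) {\<sigma>}) (\<lambda>g c. g ` c) z)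
    \<longleftrightarrow> (\<exists>n>0. (s ^^ n) z = z)" (is "finite ?O \<longleftrightarrow> _")
proof
  assume "\<exists>n>0. (s ^^ n) z = z"
  then obtain n where n: "n > 0" "(s ^^ n) z = z" by blast
  let ?F = "range (\<lambda>i. (s ^^ i) z)"
  have "?F \<subseteq> (\<lambda>i. (s ^^ i) z) ` {..<n}"
  proof
    fix w assume "w \<in> ?F"
    then obtain i where "w = (s ^^ i) z" by blast
    then have "w = (s ^^ (i mod n)) z" using funpow_mod_eq[OF n(2)] by metis
    then show "w \<in> (\<lambda>i. (s ^^ i) z) ` {..<n}" using n(1) by auto
  qed
  then have "finite ?F" by (rule finite_subset) simp
  moreover have "?O \<subseteq> ?F"
  proof
    fix w assume "w \<in> ?O"
    then obtain g where g: "g \<in> generate (ring_AutoGroup R) {\<sigma>}" "w = g ` z"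
      unfolding orbit_def carrier_generated by blast
    have sub: "(s ^^ i) z \<subseteq> carrier R" for i using s_pow_Irr[OF z] Irr_subset_carrier by blast
    \<comment> \<open>By periodicity, one step back is \<open>n - 1\<close> steps forward.\<close>
    have "\<tau> ` (s ^^ i) z \<in> ?F" for i
    proof -
      have "(s ^^ i) z = (s ^^ (i + n)) z" by (simp add: funpow_add n(2))
      also have "\<dots> = s ((s ^^ (i + n - 1)) z)" using n(1) by (cases n) auto
      finally have "\<tau> ` (s ^^ i) z = (s ^^ (i + n - 1)) z" using \<tau>_\<sigma>_image[OF sub] by simp
      then show ?thesis by blast
    qed
    moreover have "\<sigma> ` (s ^^ i) z \<in> ?F" for i
      using rangeI[of "\<lambda>i. (s ^^ i) z" "Suc i"] by simp
    moreover have "z \<in> ?F" using rangeI[of "\<lambda>i. (s ^^ i) z" 0] by simp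
    ultimately show "w \<in> ?F"
      using generate_image_closed[OF g(1), of ?F] sub g(2) by blast
  qed
  ultimately show "finite ?O" by (rule finite_subset[rotated])
next
  assume fin: "finite ?O"
  \<comment> \<open>Each power of \<open>s\<close> at \<open>z\<close> is realized by a group
    element, so the forward iterates lie in the orbit.\<close>
  have "\<exists>g\<in>generate (ring_AutoGroup R) {\<sigma>}. g \<in> Bij (carrier R) \<and> g ` z = (s ^^ i) z" for i
  proof (induction i)
    case 0
    have "(\<lambda>x\<in>carrier R. x) ` z = z"
      using Irr_subset_carrier[OF z] by (force simp: subset_iff image_iff)
    then show ?case
      using generate.one[of "ring_AutoGroup R" "{\<sigma>}"] id_Bij[of "carrier R"]
      unfolding ring_AutoGroup_one by (metis (no_types, lifting) funpow_0)
  next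
    case (Suc i)
    then obtain g where g: "g \<in> generate (ring_AutoGroup R) {\<sigma>}" "g \<in> Bij (carrier R)"
      "g ` z = (s ^^ i) z" by blast
    have "\<sigma> \<otimes>\<^bsub>ring_AutoGroup R\<^esub> g = compose (carrier R) \<sigma> g"
      using g \<sigma>_Bij by (simp add: ring_AutoGroup_def BijGroup_def)
    then have gen: "compose (carrier R) \<sigma> g \<in> generate (ring_AutoGroup R) {\<sigma>}"
      using generate.eng[OF generate.incl[of \<sigma>] g(1)] by simp
    have "compose (carrier R) \<sigma> g ` z = \<sigma> ` g ` z"
      using Irr_subset_carrier[OF z] unfolding image_image
      by (intro image_cong) (auto simp: compose_def)
    then show ?case using gen g compose_Bij[OF \<sigma>_Bij g(2)] by auto
  qed
  then have "range (\<lambda>i. (s ^^ i) z) \<subseteq> ?O"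
    unfolding orbit_def carrier_generated by clarsimp metis
  then have "\<not> inj (\<lambda>i. (s ^^ i) z)"
    using fin finite_subset by (auto dest: finite_imageD)
  then obtain i j where ij: "i < j" "(s ^^ i) z = (s ^^ j) z"
    unfolding inj_def by (metis linorder_neqE_nat)
  have inj: "(s ^^ i) v = (s ^^ i) w \<Longrightarrow> v = w" if "v \<in> Irr R" "w \<in> Irr R" for v w
  proof (induction i)
    case (Suc i)
    from Suc.prems have "s ((s ^^ i) v) = s ((s ^^ i) w)" by simp
    then have "(s ^^ i) v = (s ^^ i) w"
      by (rule inj_onD[OF inj_on_\<sigma>_image]) (use that s_pow_Irr in auto)
    then show ?case by (rule Suc.IH)
  qed simp
  have "(s ^^ i) ((s ^^ (j - i)) z) = (s ^^ (i + (j - i))) z" by (simp only: funpow_add comp_apply)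
  then have "(s ^^ i) ((s ^^ (j - i)) z) = (s ^^ i) z" using ij by simp
  then have "(s ^^ (j - i)) z = z" using inj s_pow_Irr z by blast
  then show "\<exists>n>0. (s ^^ n) z = z" using ij(1) by (intro exI[of _ "j - i"]) simp
qed

lemma infinite_Irr_orbits_iff:
  "(\<forall>\<O>\<in>Irr_orbits R \<sigma>. infinite \<O>) \<longleftrightarrow> (\<forall>z\<in>Irr R. \<forall>n>0. (s ^^ n) z \<noteq> z)"
proof -
  have "(\<forall>\<O>\<in>Irr_orbits R \<sigma>. infinite \<O>) \<longleftrightarrow> (\<forall>z\<in>Irr R.
      infinite (orbit (subgroup_generated (ring_AutoGroup R) {\<sigma>}) (\<lambda>g c. g ` c) z))"
    unfolding Irr_orbits_def orbits_def by blast
  then show ?thesis using finite_orbit_iff by blast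
qed

lemma \<sigma>_pow_closed: "r \<in> carrier R \<Longrightarrow> (\<sigma> ^^ n) r \<in> carrier R"
  by (induction n) auto

lemma \<sigma>_pow_nonzero: "r \<in> carrier R \<Longrightarrow> r \<noteq> \<zero> \<Longrightarrow> (\<sigma> ^^ n) r \<noteq> \<zero>"
  by (induction n) (auto simp: \<sigma>_pow_closed)

lemma s_pow_assoc_class:
  assumes "r \<in> carrier R" "r \<noteq> \<zero>"
  shows "(s ^^ n) (assoc_class R r) = assoc_class R ((\<sigma> ^^ n) r)"
  using assms by (induction n) (auto simp: \<sigma>_image_assoc_class \<sigma>_pow_closed \<sigma>_pow_nonzero)

text \<open>Frees the order from representatives, so that it can be handled through the shift on
  classes alone.\<close>

lemma Irr_le_iff:
  assumes "z \<in> Irr R" "w \<in> Irr R"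
  shows "Irr_le R \<sigma> z w \<longleftrightarrow> (\<exists>n. (s ^^ n) z = w)"
proof
  assume "Irr_le R \<sigma> z w"
  then show "\<exists>n. (s ^^ n) z = w"
    unfolding Irr_le_def using ring_irreducibleE(1) s_pow_assoc_class by metis
next
  assume "\<exists>n. (s ^^ n) z = w"
  moreover obtain r where "r \<in> carrier R" "r \<noteq> \<zero>" "ring_irreducible r" "z = assoc_class R r"
    using assms(1) by (rule IrrE)
  moreover obtain r' where "r' \<in> carrier R" "r' \<noteq> \<zero>" "ring_irreducible r'" "w = assoc_class R r'"
    using assms(2) by (rule IrrE)
  ultimately show "Irr_le R \<sigma> z w"
    unfolding Irr_le_def using s_pow_assoc_class by metis
qed

section \<open>Submodules as ideals\<close>

lemma submodule_smult:
  assumes "submodule N A V" "t \<in> gwa_terms R" "r \<in> N"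
  shows "gwa_act R \<sigma> p q t r \<in> N"
proof -
  interpret N: submodule N A V by fact
  have "r \<in> carrier R" using N.subset assms(3) by (auto simp: gwa_V_simps)
  moreover have "gwa_class R \<sigma> a t \<in> carrier A" using assms(2) by (auto simp: gwa_simps)
  ultimately show ?thesis using N.smult_closed[of "gwa_class R \<sigma> a t" r] assms by (simp add: gwa_V_smult)
qed

lemma submodule_imp_ideal:
  assumes "submodule N A V" shows "ideal N R"
proof -
  interpret N: submodule N A V by fact
  have sub: "N \<subseteq> carrier R" using N.subset by (simp add: gwa_V_simps)
  have mult: "c \<otimes> r \<in> N" if "c \<in> carrier R" "r \<in> N" for c r
    using submodule_smult[OF assms, of "Coeff c" r] that by simp
  have "subgroup N (add_monoid R)"
  proof (rule add.subgroupI)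
    show "N \<noteq> {}" using N.one_closed by auto
    show "\<ominus> r \<in> N" if "r \<in> N" for r
    proof -
      have "r \<in> carrier R" using that sub by blast
      then have "\<ominus> \<one> \<otimes> r = \<ominus> r" by (simp add: l_minus)
      then show ?thesis using mult[of "\<ominus> \<one>" r] that by simp
    qed
    show "r \<oplus> r' \<in> N" if "r \<in> N" "r' \<in> N" for r r'
      using N.m_closed[OF that] by (simp add: gwa_V_simps)
  qed (rule sub)
  then show ?thesis
    by (rule idealI[OF ring_axioms]) (use mult sub m_comm in fastforce)+
qed

text \<open>Stability under the two generators is enough, by induction on the term representing a
  scalar.\<close>

lemma ideal_imp_submodule:
  assumes "ideal N R" and x: "\<And>r. r \<in> N \<Longrightarrow> \<tau> r \<otimes> p \<in> N" and y: "\<And>r. r \<in> N \<Longrightarrow> \<sigma> r \<otimes> q \<in> N"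
  shows "submodule N A V"
proof -
  interpret N: ideal N R by fact
  have act: "t \<in> gwa_terms R \<Longrightarrow> r \<in> N \<Longrightarrow> gwa_act R \<sigma> p q t r \<in> N" for t r
    by (induction t arbitrary: r) (auto simp: x y N.I_l_closed)
  \<comment> \<open>Both sides are the same description over the same carrier and addition, so the
    equation holds for arbitrary \<open>r\<close>.\<close>
  have inv_eq: "inv\<^bsub>add_monoid V\<^esub> r = \<ominus> r" for r
    by (simp add: m_inv_def a_inv_def gwa_V_simps)
  show ?thesis
  proof
    show "N \<subseteq> carrier (add_monoid V)" using N.a_subset by (simp add: gwa_V_simps)
    show "inv\<^bsub>add_monoid V\<^esub> r \<in> N" if "r \<in> N" for r using that by (simp add: inv_eq)
    show "c \<odot>\<^bsub>V\<^esub> r \<in> N" if "c \<in> carrier A" "r \<in> N" for c r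
    proof -
      obtain t where t: "t \<in> gwa_terms R" "c = gwa_class R \<sigma> a t" using \<open>c \<in> carrier A\<close> by (auto simp: gwa_simps)
      then show ?thesis using act[OF t(1) \<open>r \<in> N\<close>] N.Icarr[OF \<open>r \<in> N\<close>] by (simp add: gwa_V_smult)
    qed
  qed (auto simp: gwa_V_simps)
qed

lemma mem_PIdl_iff:
  assumes "c \<in> carrier R" shows "r \<in> PIdl c \<longleftrightarrow> c divides r"
  using assms by (auto simp: cgenideal_def factor_def m_comm)

lemma submodule_generator:
  assumes "submodule N A V" "N \<noteq> {\<zero>}"
  obtains c where "c \<in> carrier R" "c \<noteq> \<zero>" "N = PIdl c"
proof -
  obtain c where c: "c \<in> carrier R" "N = PIdl c"
    using exists_gen[OF submodule_imp_ideal[OF assms(1)]] by blast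
  moreover have "c \<noteq> \<zero>"
  proof
    assume "c = \<zero>"
    then have "N = {\<zero>}" using c mem_PIdl_iff zero_divides by blast
    then show False using assms(2) by simp
  qed
  ultimately show thesis using that by blast
qed

lemma submodule_PIdlD:
  assumes "submodule (PIdl c) A V" "c \<in> carrier R"
  shows "c divides \<tau> c \<otimes> p" "c divides \<sigma> c \<otimes> q"
proof -
  have "c \<in> PIdl c" using assms(2) by (rule cgenideal_self)
  then have "gwa_act R \<sigma> p q GenX c \<in> PIdl c" "gwa_act R \<sigma> p q GenY c \<in> PIdl c"
    using submodule_smult[OF assms(1), of GenX c] submodule_smult[OF assms(1), of GenY c]
    by simp_all
  then show "c divides \<tau> c \<otimes> p" "c divides \<sigma> c \<otimes> q"
    using mem_PIdl_iff[OF assms(2)] by simp_all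
qed

section \<open>The length when all orbits are infinite\<close>

lemma aperiodic_shiftI:
  assumes "\<forall>z\<in>Irr R. \<forall>n>0. (s ^^ n) z \<noteq> z"
  shows "aperiodic_shift (Irr R) s ((`) \<tau>)"
  using assms
  by unfold_locales (auto simp: \<sigma>_Irr \<tau>_Irr \<sigma>_\<tau>_image \<tau>_\<sigma>_image Irr_subset_carrier)

definition multiplicity_of :: "'a \<Rightarrow> 'a set \<Rightarrow> int" where
  "multiplicity_of c z = int (count (Irr_mset R c) z)"

text \<open>This is the \<open>U\<close> of the energy bound for the multiplicities of
  \<open>q\<close>; its recurrence is \<open>below_count_step\<close>.\<close>

definition below_count :: "'a set \<Rightarrow> int" where
  "below_count z = int (size {#v \<in># Irr_mset R q. Irr_le R \<sigma> v z#})"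

text \<open>The generator divides its images under \<open>x\<close> and \<open>y\<close>; comparing
  multiplicities class by class gives the two inequalities, with shifts as in the transport
  lemmas.\<close>

lemma admissible_generator:
  assumes ap: "\<forall>z\<in>Irr R. \<forall>n>0. (s ^^ n) z \<noteq> z"
    and N: "submodule (PIdl c) A V" and c: "c \<in> carrier R" "c \<noteq> \<zero>"
  shows "aperiodic_shift.admissible (Irr R) s ((`) \<tau>) (multiplicity_of p) (multiplicity_of q) (multiplicity_of c)"
proof -
  interpret S: aperiodic_shift "Irr R" s "(`) \<tau>" by (rule aperiodic_shiftI[OF ap])
  have "Irr_mset R c \<subseteq># Irr_mset R (\<tau> c \<otimes> p)"
    using submodule_PIdlD(1)[OF N c(1)] c p_nonzero by (subst Irr_mset_subset_iff) (auto simp: integral_iff)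
  then have x: "Irr_mset R c \<subseteq># Irr_mset R (\<tau> c) + Irr_mset R p"
    using c p_nonzero by (simp add: Irr_mset_mult)
  have "Irr_mset R c \<subseteq># Irr_mset R (\<sigma> c \<otimes> q)"
    using submodule_PIdlD(2)[OF N c(1)] c q_nonzero
    by (subst Irr_mset_subset_iff) (auto simp: integral_iff q_carrier)
  then have y: "Irr_mset R c \<subseteq># Irr_mset R (\<sigma> c) + Irr_mset R q"
    using c q_nonzero by (simp add: Irr_mset_mult q_carrier)
  have eq: "{z. multiplicity_of c z \<noteq> 0} = set_mset (Irr_mset R c)" by (auto simp: multiplicity_of_def)
  show ?thesis unfolding S.admissible_def eq
  proof (intro conjI allI ballI)
    fix z assume z: "z \<in> Irr R"
    show "multiplicity_of c z \<le> multiplicity_of c (\<sigma> ` z) + multiplicity_of p z"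
      using mset_subset_eq_count[OF x, of z] by (simp add: multiplicity_of_def count_Irr_mset_\<tau> c z)
    show "multiplicity_of c z \<le> multiplicity_of c (\<tau> ` z) + multiplicity_of q z"
      using mset_subset_eq_count[OF y, of z] by (simp add: multiplicity_of_def count_Irr_mset_\<sigma>' c z)
  qed (use set_Irr_mset[OF c] in \<open>auto simp: multiplicity_of_def\<close>)
qed

text \<open>A class precedes \<open>z\<close> exactly when it precedes the predecessor of
  \<open>z\<close> or equals \<open>z\<close>. Aperiodicity makes the alternatives exclusive, so the
  second contributes the multiplicity of \<open>z\<close> in \<open>q\<close>.\<close>

lemma below_count_step:
  assumes ap: "\<forall>z\<in>Irr R. \<forall>n>0. (s ^^ n) z \<noteq> z" and z: "z \<in> Irr R"
  shows "below_count z = below_count (\<tau> ` z) + multiplicity_of q z"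
proof -
  have le: "Irr_le R \<sigma> v z \<longleftrightarrow> Irr_le R \<sigma> v (\<tau> ` z) \<or> v = z" if "v \<in> Irr R" for v
  proof -
    have step: "(s ^^ Suc n) v = z \<longleftrightarrow> (s ^^ n) v = \<tau> ` z" for n
      using \<tau>_\<sigma>_image[OF Irr_subset_carrier[OF s_pow_Irr[OF that, of n]]]
        \<sigma>_\<tau>_image[OF Irr_subset_carrier[OF z]]
      unfolding funpow.simps(2) comp_apply by metis
    have "(\<exists>n. (s ^^ n) v = z) \<longleftrightarrow> (\<exists>n. (s ^^ Suc n) v = z) \<or> v = z"
      by (metis funpow_0 not0_implies_Suc)
    also have "\<dots> \<longleftrightarrow> (\<exists>n. (s ^^ n) v = \<tau> ` z) \<or> v = z"
      unfolding step ..
    finally show ?thesis by (simp add: Irr_le_iff that z \<tau>_Irr)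
  qed
  have not_le: "\<not> Irr_le R \<sigma> z (\<tau> ` z)"
  proof
    assume "Irr_le R \<sigma> z (\<tau> ` z)"
    then obtain n where "(s ^^ n) z = \<tau> ` z" using Irr_le_iff z \<tau>_Irr by blast
    then have "(s ^^ Suc n) z = z" using \<sigma>_\<tau>_image[OF Irr_subset_carrier[OF z]] by simp
    then show False using ap z by blast
  qed
  have "{#v \<in># Irr_mset R q. Irr_le R \<sigma> v z#}
      = {#v \<in># Irr_mset R q. Irr_le R \<sigma> v (\<tau> ` z)#} + {#v \<in># Irr_mset R q. v = z#}"
  proof (rule multiset_eqI)
    fix v
    show "count {#v \<in># Irr_mset R q. Irr_le R \<sigma> v z#} v =
      count ({#v \<in># Irr_mset R q. Irr_le R \<sigma> v (\<tau> ` z)#} + {#v \<in># Irr_mset R q. v = z#}) v"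
    proof (cases "v \<in> Irr R")
      case True
      then show ?thesis using le[OF True] not_le by auto
    next
      case False
      then have "count (Irr_mset R q) v = 0"
        using set_Irr_mset[OF q_carrier q_nonzero] by (meson count_inI subsetD)
      then show ?thesis by auto
    qed
  qed
  then show ?thesis
    by (simp add: below_count_def multiplicity_of_def filter_eq_replicate_mset)
qed

lemma sum_below_count_le_Omega:
  assumes "finite Z"
  shows "(\<Sum>z\<in>Z. multiplicity_of p z * below_count z) \<le> int (size (Omega R \<sigma> p q))"
proof -
  let ?U = "\<lambda>w. size {#v \<in># Irr_mset R q. Irr_le R \<sigma> v w#}"
  have "(\<Sum>z\<in>Z. multiplicity_of p z * below_count z) = int (\<Sum>z\<in>Z. count (Irr_mset R p) z * ?U z)"
    by (simp add: multiplicity_of_def below_count_def)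
  also have "\<dots> \<le> int (\<Sum>w\<in>#Irr_mset R p. ?U w)"
    by (rule of_nat_mono[OF sum_count_mult_le_sum_mset[OF assms]])
  also have "\<dots> = int (size (Omega R \<sigma> p q))"
    by (simp add: Omega_def size_filter_pairs)
  finally show ?thesis .
qed

text \<open>Only the bottom of a strict chain can be zero, so all later terms have nonzero
  generators. Larger ideals have smaller multiplicities, and the energy bounds the remaining
  \<open>k = n - 1\<close> steps.\<close>

lemma chain_length_le:
  assumes ap: "\<forall>z\<in>Irr R. \<forall>n>0. (s ^^ n) z \<noteq> z"
    and N: "\<And>i. i \<le> n \<Longrightarrow> submodule (N i) A V" and strict: "\<And>i. i < n \<Longrightarrow> N i \<subset> N (Suc i)"
  shows "n \<le> 1 + size (Omega R \<sigma> p q)"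
proof (cases n)
  case (Suc k)
  interpret S: aperiodic_shift "Irr R" s "(`) \<tau>" by (rule aperiodic_shiftI[OF ap])
  \<comment> \<open>Indices move by one: the generator number \<open>i\<close> belongs to
    \<open>N (Suc i)\<close>, which is nonzero because it strictly contains
    \<open>N i\<close>.\<close>
  have "\<exists>c. c \<in> carrier R \<and> c \<noteq> \<zero> \<and> N (Suc i) = PIdl c" if "i \<le> k" for i
  proof -
    have "\<zero> \<in> N i"
      using submodule_imp_ideal[OF N[of i]] that Suc additive_subgroup.zero_closed ideal.axioms(1) by fastforce
    then have "N (Suc i) \<noteq> {\<zero>}" using strict[of i] that Suc by auto
    then show ?thesis using submodule_generator[OF N[of "Suc i"]] that Suc by (metis Suc_le_mono)
  qed
  then obtain c where c: "\<And>i. i \<le> k \<Longrightarrow> c i \<in> carrier R" "\<And>i. i \<le> k \<Longrightarrow> c i \<noteq> \<zero>"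
    "\<And>i. i \<le> k \<Longrightarrow> N (Suc i) = PIdl (c i)" by metis
  have dec: "multiplicity_of (c (Suc i)) \<le> multiplicity_of (c i) \<and> multiplicity_of (c (Suc i)) \<noteq> multiplicity_of (c i)" if "i < k" for i
  proof -
    have ss: "PIdl (c i) \<subset> PIdl (c (Suc i))" using strict[of "Suc i"] c(3)[of i] c(3)[of "Suc i"] that Suc by simp
    have cs: "c i \<in> carrier R" "c i \<noteq> \<zero>" "c (Suc i) \<in> carrier R" "c (Suc i) \<noteq> \<zero>"
      using c that by auto
    have "c (Suc i) divides c i"
      using ss to_contain_is_to_divide[OF cs(3,1)] by blast
    then have "Irr_mset R (c (Suc i)) \<subseteq># Irr_mset R (c i)"
      using Irr_mset_subset_iff[OF cs(3,4,1,2)] by blast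
    then have "multiplicity_of (c (Suc i)) \<le> multiplicity_of (c i)"
      by (auto simp: le_fun_def multiplicity_of_def mset_subset_eq_count)
    moreover have "multiplicity_of (c (Suc i)) \<noteq> multiplicity_of (c i)"
    proof
      assume "multiplicity_of (c (Suc i)) = multiplicity_of (c i)"
      then have "Irr_mset R (c (Suc i)) = Irr_mset R (c i)"
        by (intro multiset_eqI) (metis multiplicity_of_def of_nat_eq_iff)
      then have "c i divides c (Suc i)" using Irr_mset_subset_iff[OF cs] by simp
      then show False using ss to_contain_is_to_divide[OF cs(1,3)] by blast
    qed
    ultimately show ?thesis by blast
  qed
  have adm: "S.admissible (multiplicity_of p) (multiplicity_of q) (multiplicity_of (c i))" if "i \<le> k" for i
    using admissible_generator[OF ap, of "c i"] N[of "Suc i"] c[OF that] that Suc by simp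
  obtain Z where "finite Z" "int k \<le> (\<Sum>z\<in>Z. multiplicity_of p z * below_count z)"
  proof (rule S.admissible_chain_length[where P = "multiplicity_of p" and Q = "multiplicity_of q" and k = k
        and M = "\<lambda>i. multiplicity_of (c i)" and U = below_count])
    show "0 \<le> below_count z" "0 \<le> multiplicity_of q z" for z
      by (simp_all add: below_count_def multiplicity_of_def)
  qed (use adm dec below_count_step[OF ap] in blast)+
  then have "int k \<le> int (size (Omega R \<sigma> p q))" using sum_below_count_le_Omega order_trans by blast
  then show ?thesis using Suc by simp
qed simp

lemma module_length_le:
  assumes "\<forall>z\<in>Irr R. \<forall>n>0. (s ^^ n) z \<noteq> z"
  shows "module_length A V \<le> 1 + enat (size (Omega R \<sigma> p q))"
  unfolding module_length_def
proof (rule Sup_least)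
  fix l assume "l \<in> {enat n |n. \<exists>N. (\<forall>i\<le>n. submodule (N i) A V) \<and> (\<forall>i<n. N i \<subset> N (Suc i))}"
  then obtain n N where "l = enat n" "\<And>i. i \<le> n \<Longrightarrow> submodule (N i) A V" "\<And>i. i < n \<Longrightarrow> N i \<subset> N (Suc i)"
    by blast
  then show "l \<le> 1 + enat (size (Omega R \<sigma> p q))"
    using chain_length_le[OF assms, of n N] by (simp add: one_enat_def)
qed

section \<open>The length when some orbit is finite\<close>

text \<open>Take the product of the iterates of \<open>r\<close> over one period: \<sigma> replaces
  its factor \<open>r\<close> by the associate \<open>(\<sigma> ^^ n) r\<close>, so the product
  changes only by a unit.\<close>

lemma ex_invariant_nonunit:
  assumes z: "z \<in> Irr R" and n: "n > 0" "(s ^^ n) z = z"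
  obtains c where "c \<in> carrier R" "c \<noteq> \<zero>" "c \<notin> Units R" "c divides \<sigma> c" "c divides \<tau> c"
proof -
  obtain r where r: "r \<in> carrier R" "r \<noteq> \<zero>" "ring_irreducible r" "z = assoc_class R r"
    using z by (rule IrrE)
  \<comment> \<open>\<open>d k\<close> is the product of the first \<open>k\<close> iterates of
    \<open>r\<close>, starting with \<open>r\<close> itself.\<close>
  define d where "d = rec_nat \<one> (\<lambda>_ x. \<sigma> x \<otimes> r)"
  have d_simps [simp]: "d 0 = \<one>" "d (Suc k) = \<sigma> (d k) \<otimes> r" for k by (simp_all add: d_def)
  have d [simp]: "d k \<in> carrier R" for k by (induction k) (auto simp: r)
  have d0: "d k \<noteq> \<zero>" for k by (induction k) (auto simp: r integral_iff)
  \<comment> \<open>Both sides are the product of the first \<open>k + 1\<close> iterates, with the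
    first or the last one split off.\<close>
  have d_Suc: "\<sigma> (d k) \<otimes> r = d k \<otimes> (\<sigma> ^^ k) r" for k
  proof (induction k)
    case (Suc k)
    have "\<sigma> (d (Suc k)) \<otimes> r = \<sigma> (d k \<otimes> (\<sigma> ^^ k) r) \<otimes> r" using Suc by simp
    also have "\<dots> = d (Suc k) \<otimes> (\<sigma> ^^ Suc k) r" using r \<sigma>_pow_closed by (simp add: m_ac)
    finally show ?case .
  qed (use r in simp)
  have "assoc_class R ((\<sigma> ^^ n) r) = assoc_class R r" using n r s_pow_assoc_class by simp
  then have "(\<sigma> ^^ n) r \<sim>\<^bsub>mult_of R\<^esub> r"
    using r \<sigma>_pow_closed \<sigma>_pow_nonzero unfolding assoc_class_def
    by (intro mult_of.assocs_eqD) auto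
  then have "(\<sigma> ^^ n) r \<sim> r" using assoc_iff_assoc_mult r \<sigma>_pow_closed by blast
  then obtain u where u: "u \<in> Units R" "(\<sigma> ^^ n) r = u \<otimes> r"
    using ring_associated_iff r \<sigma>_pow_closed by blast
  have uc [simp]: "u \<in> carrier R" using u by (rule_tac Units_closed)
  have "\<sigma> (d n) \<otimes> r = (d n \<otimes> u) \<otimes> r" using d_Suc[of n] u r by (simp add: m_assoc)
  then have \<sigma>d: "\<sigma> (d n) = d n \<otimes> u" using r m_rcancel by simp
  have "d n divides \<sigma> (d n)" unfolding \<sigma>d by (rule dividesI) simp_all
  moreover have "d n divides \<tau> (d n)"
  proof (rule dividesI)
    have "\<tau> (d n) = \<tau> (d n) \<otimes> \<tau> u \<otimes> inv (\<tau> u)" using \<tau>_Units[OF u(1)] by (simp add: m_assoc)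
    also have "\<tau> (d n) \<otimes> \<tau> u = d n" using arg_cong[OF \<sigma>d, of \<tau>] by simp
    finally show "\<tau> (d n) = d n \<otimes> inv (\<tau> u)" .
  qed (use \<tau>_Units[OF u(1)] in simp)
  moreover have "d n \<notin> Units R"
  proof
    assume "d n \<in> Units R"
    \<comment> \<open>Positivity of \<open>n\<close> ensures that \<open>r\<close> occurs as a
      factor of \<open>d n\<close>.\<close>
    moreover obtain k where "n = Suc k" using n(1) by (cases n) auto
    ultimately have "r \<otimes> \<sigma> (d k) \<in> Units R" using r by (simp add: m_comm)
    then have "r \<in> Units R" using r by (intro unit_factor[of r "\<sigma> (d k)"]) auto
    then show False using ring_irreducibleE(4) r by blast
  qed
  ultimately show thesis using that[of "d n"] d0 by simp
qed

lemma submodule_PIdl: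
  assumes "c \<in> carrier R" "c divides \<sigma> c" "c divides \<tau> c"
  shows "submodule (PIdl c) A V"
proof (rule ideal_imp_submodule)
  show "ideal (PIdl c) R" using assms(1) by (rule cgenideal_ideal)
  fix r assume "r \<in> PIdl c"
  then obtain e where e: "e \<in> carrier R" "r = e \<otimes> c" by (auto simp: cgenideal_def)
  show "\<tau> r \<otimes> p \<in> PIdl c"
  proof -
    obtain f where "f \<in> carrier R" "\<tau> c = c \<otimes> f" using assms(3) by (auto simp: factor_def)
    then have "\<tau> r \<otimes> p = c \<otimes> (f \<otimes> \<tau> e \<otimes> p)" "f \<otimes> \<tau> e \<otimes> p \<in> carrier R"
      using e assms(1) by (simp_all add: m_ac)
    then show ?thesis using mem_PIdl_iff[OF assms(1)] by (auto simp: factor_def)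
  qed
  show "\<sigma> r \<otimes> q \<in> PIdl c"
  proof -
    obtain f where "f \<in> carrier R" "\<sigma> c = c \<otimes> f" using assms(2) by (auto simp: factor_def)
    then have "\<sigma> r \<otimes> q = c \<otimes> (f \<otimes> \<sigma> e \<otimes> q)" "f \<otimes> \<sigma> e \<otimes> q \<in> carrier R"
      using e assms(1) q_carrier by (simp_all add: m_ac)
    then show ?thesis using mem_PIdl_iff[OF assms(1)] by (auto simp: factor_def)
  qed
qed

lemma divides_mult_mono:
  assumes "c \<in> carrier R" "c' \<in> carrier R" "c divides d" "c' divides d'"
  shows "c \<otimes> c' divides d \<otimes> d'"
proof -
  obtain e e' where "e \<in> carrier R" "d = c \<otimes> e" "e' \<in> carrier R" "d' = c' \<otimes> e'"
    using assms by (auto simp: factor_def)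
  then show ?thesis using assms by (intro dividesI[of "e \<otimes> e'"]) (simp_all add: m_ac)
qed

lemma module_length_infinite:
  assumes "z \<in> Irr R" "n > 0" "(s ^^ n) z = z"
  shows "module_length A V = \<infinity>"
proof -
  obtain c where c: "c \<in> carrier R" "c \<noteq> \<zero>" "c \<notin> Units R" "c divides \<sigma> c" "c divides \<tau> c"
    using ex_invariant_nonunit[OF assms] .
  have inv: "c [^] k divides \<sigma> (c [^] k) \<and> c [^] k divides \<tau> (c [^] k)" for k :: nat
  proof (induction k)
    case 0
    show ?case by (simp add: one_divides)
  next
    case (Suc k)
    then show ?case using c by (simp add: divides_mult_mono)
  qed
  have nz: "c [^] k \<noteq> \<zero>" for k :: nat using c by (induction k) (auto simp: integral_iff)
  have strict: "PIdl (c [^] Suc k) \<subset> PIdl (c [^] k)" for k :: nat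
  proof -
    have "c [^] k divides c [^] Suc k" using c by (intro dividesI[of c]) auto
    moreover have "\<not> c [^] Suc k divides c [^] k"
    proof
      assume "c [^] Suc k divides c [^] k"
      then obtain e where e: "e \<in> carrier R" "c [^] k = c [^] Suc k \<otimes> e" by (auto simp: factor_def)
      have "c [^] Suc k \<otimes> e = c [^] k \<otimes> (c \<otimes> e)" using c(1) e(1) by (simp add: m_assoc)
      with e(2) have "c [^] k \<otimes> \<one> = c [^] k \<otimes> (c \<otimes> e)" using c(1) by (metis nat_pow_closed r_one)
      \<comment> \<open>Cancelling the nonzero \<open>c [^] k\<close> would make \<open>c\<close> a
        unit.\<close>
      then have "\<one> = c \<otimes> e"
        using m_lcancel[OF nz[of k], of \<one> "c \<otimes> e"] c(1) e(1) by blast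
      then show False using c(3) e(1) divides_one[OF c(1)] unfolding factor_def by blast
    qed
    moreover have "c [^] k \<in> carrier R" "c [^] Suc k \<in> carrier R" using c(1) by auto
    ultimately show ?thesis using to_contain_is_to_divide by blast
  qed
  have le: "enat k \<le> module_length A V" for k
    unfolding module_length_def
  proof (rule Sup_upper)
    \<comment> \<open>The ideals of the powers descend while length counts ascending chains, hence
      the reversed exponent; \<open>i = k\<close> gives the unit ideal.\<close>
    let ?N = "\<lambda>i. PIdl (c [^] (k - i))"
    have "submodule (?N i) A V" for i using inv[of "k - i"] c by (intro submodule_PIdl) auto
    moreover have "?N i \<subset> ?N (Suc i)" if "i < k" for i
      using strict[of "k - Suc i"] that by (simp only: Suc_diff_Suc)
    ultimately show "enat k \<in> {enat n |n. \<exists>N. (\<forall>i\<le>n. submodule (N i) A V) \<and> (\<forall>i<n. N i \<subset> N (Suc i))}"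
      by (intro CollectI exI[of _ k] exI[of _ ?N] conjI allI impI refl) simp_all
  qed
  show ?thesis
  proof (cases "module_length A V")
    case (enat m)
    \<comment> \<open>A finite length \<open>m\<close> is refuted by the chain with
      \<open>m + 1\<close> steps.\<close>
    then show ?thesis using le[of "Suc m"] by simp
  qed
qed

end

theorem theorem3p5:
  fixes R :: "('a, 'm) ring_scheme" and \<sigma> :: "'a \<Rightarrow> 'a" and a p q :: 'a
  assumes "principal_domain R"
    and "\<sigma> \<in> carrier (ring_AutoGroup R)"
    and "a \<in> carrier R" and "a \<noteq> \<zero>\<^bsub>R\<^esub>"
    and "p \<in> carrier R" and "p divides\<^bsub>R\<^esub> a"
    and "q = \<sigma> (ring_quotient R a p)"
  shows "(finite_length (gwa R \<sigma> a) (gwa_V R \<sigma> p q) \<longleftrightarrow> (\<forall>\<O>\<in>Irr_orbits R \<sigma>. infinite \<O>)) \<and>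
    (finite_length (gwa R \<sigma> a) (gwa_V R \<sigma> p q) \<longrightarrow>
       module_length (gwa R \<sigma> a) (gwa_V R \<sigma> p q) \<le> 1 + enat (size (Omega R \<sigma> p q)))"
proof -
  interpret principal_domain R by fact
  obtain b where b: "b \<in> carrier R" "a = p \<otimes>\<^bsub>R\<^esub> b" using assms(6) unfolding factor_def by blast
  have "p \<noteq> \<zero>\<^bsub>R\<^esub>" using b assms(4) by auto
  then have q: "q = \<sigma> b" using b assms(5,7) ring_quotient_eq by simp
  interpret gwa_V_pid R \<sigma> a p b q
    by unfold_locales (fact assms b q)+
  have "\<forall>z\<in>Irr R. \<forall>n>0. (s ^^ n) z \<noteq> z" if "finite_length A V"
  proof (intro ballI allI impI notI)
    fix z n assume "z \<in> Irr R" "0 < n" "(s ^^ n) z = z"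
    then have "module_length A V = \<infinity>" by (rule module_length_infinite)
    then show False using that by (simp add: finite_length_def)
  qed
  moreover have "finite_length A V" if "\<forall>z\<in>Irr R. \<forall>n>0. (s ^^ n) z \<noteq> z"
  proof -
    have "module_length A V \<le> enat (1 + size (Omega R \<sigma> p q))"
      using module_length_le[OF that] by (simp add: one_enat_def)
    then show ?thesis unfolding finite_length_def by (cases "module_length A V") simp_all
  qed
  \<comment> \<open>The bound is available for aperiodic shifts, a condition that finite length
    implies by the first fact.\<close>
  ultimately show ?thesis using module_length_le infinite_Irr_orbits_iff by blast
qed

end
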